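(* Consider the setting described in the context, assume A1–A5, and let $s=\frac{r}{2-4r}$. A sequence $f_n$ with $cn^{-r}\le\|f_n\|\le Cn^{-r}$ (constants $0<c<C$) is purely $n^{-r}$-consistent if and only if for every $\varepsilon>0$ there are $P_\varepsilon>0$ and a sequence $f_{1n}\in\bar{\mathbb{B}}^s_{2\infty}(P_\varepsilon)$ such that $\|f_n-f_{1n}\|\le\varepsilon n^{-r}$ and $\|f_n\|^2=\|f_{1n}\|^2+\|f_n-f_{1n}\|^2$.
   Context: Fix $\sigma>0$, $0<r<1/2$ and an orthonormal basis $(\phi_j)_{j\ge1}$ of $\mathbb{L}_2(0,1)$. For each $n$ one observes $dY_n(t)=f(t)\,dt+\sigma n^{-1/2}dw(t)$, equivalently $y_j=\theta_j+\sigma n^{-1/2}\xi_j$, $\theta_j=\int_0^1f\phi_j$, $\xi_j$ i.i.d. $N(0,1)$; $H_0:f=0$. Weights $\kappa_{nj}^2\ge0$, $\rho_n=\sum_j\kappa_{nj}^2$, $T_n(Y_n)=\sum_j\kappa_{nj}^2y_j^2-\sigma^2n^{-1}\rho_n$, $k_n=\sup\{k:\sum_{j<k}\kappa_{nj}^2\le\rho_n/2\}$, $\kappa_n^2=\kappa_{nk_n}^2$. Assumptions: (A1) $j\mapsto\kappa_{nj}^2$ decreasing; (A2) $C_1<\sigma^{-4}n^2\sum_j\kappa_{nj}^4<C_2$; (A3) $c_1n^{-2r}\le\rho_n\le c_2n^{-2r}$; (A4) $\exists C_1>0,\lambda>1$: $\kappa^2_{n,[(1+\delta)k_n]}<C_1(1+\delta)^{-\lambda}\kappa_n^2$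 for all $\delta>0,n$; (A5) $\kappa_{n1}^2\asymp\kappa_n^2$ and for each $c>1$ there is $C>0$ with $\kappa^2_{n,[ck_n]}\ge C\kappa_n^2$. A test generated by $T_n$ rejects $H_0$ iff $T_n$ exceeds a threshold. A (sub)sequence $f_{n_i}$ is consistent if for every $\alpha\in(0,1)$ and every sequence of tests $K_{n_i}$ generated by $T_{n_i}$ with $\alpha(K_{n_i})=\alpha(1+o(1))$, $\limsup_i\beta(K_{n_i},f_{n_i})<1-\alpha$; inconsistent if for every sequence of such tests (any level) $\liminf_i(\alpha(K_{n_i})+\beta(K_{n_i},f_{n_i}))\ge1$. $f_n$ is $n^{-r}$-consistent if consistent with $cn^{-r}<\|f_n\|<Cn^{-r}$ for some $0<c<C$; it is purely $n^{-r}$-consistent if there is no subsequence with $f_{n_i}=f_{1n_i}+f_{2n_i}$, $f_{2n_i}\perp f_{1n_i}$, $\|f_{2n_i}\|>c_1n_i^{-r}$ for some $c_1>0$, and $f_{2n_i}$ inconsistent. $\bar{\mathbb{B}}^s_{2\infty}(P_0)=\{f=\sum_j\theta_j\phi_j:\ \sup_{\lambda>0}\lambda^{2s}\sum_{j>\lambda}\theta_j^2\le P_0\}$. *)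

theory Defs
  imports "HOL-Probability.Probability"
begin

(* Functions f in L2(0,1) are represented by their coefficient sequences
   theta_j = <f, phi_j>, j >= 1 (the value at index 0 is ignored). *)

definition ell2 :: "(nat \<Rightarrow> real) \<Rightarrow> bool" where
  "ell2 \<theta> \<longleftrightarrow> (\<lambda>j. (\<theta> j)^2) summable_on {1..}"

definition l2norm :: "(nat \<Rightarrow> real) \<Rightarrow> real" where
  "l2norm \<theta> = sqrt (\<Sum>\<^sub>\<infinity>j\<in>{1..}. (\<theta> j)^2)"

definition l2inner :: "(nat \<Rightarrow> real) \<Rightarrow> (nat \<Rightarrow> real) \<Rightarrow> real" where
  "l2inner \<theta> \<eta> = (\<Sum>\<^sub>\<infinity>j\<in>{1..}. \<theta> j * \<eta> j)"

(* kappa n j stands for kappa_{nj}^2 *)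
definition rho :: "(nat \<Rightarrow> nat \<Rightarrow> real) \<Rightarrow> nat \<Rightarrow> real" where
  "rho \<kappa> n = (\<Sum>\<^sub>\<infinity>j\<in>{1..}. \<kappa> n j)"

definition kn :: "(nat \<Rightarrow> nat \<Rightarrow> real) \<Rightarrow> nat \<Rightarrow> nat" where
  "kn \<kappa> n = Sup {k::nat. (\<Sum>j\<in>{1..<k}. \<kappa> n j) \<le> rho \<kappa> n / 2}"

definition kappa_n :: "(nat \<Rightarrow> nat \<Rightarrow> real) \<Rightarrow> nat \<Rightarrow> real" where
  "kappa_n \<kappa> n = \<kappa> n (kn \<kappa> n)"

(* T_n(Y_n) with y_j = theta_j + sigma n^{-1/2} xi_j *)
definition Tstat :: "real \<Rightarrow> (nat \<Rightarrow> nat \<Rightarrow> real) \<Rightarrow> (nat \<Rightarrow> 'a \<Rightarrow> real) \<Rightarrow> nat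
    \<Rightarrow> (nat \<Rightarrow> real) \<Rightarrow> 'a \<Rightarrow> real" where
  "Tstat \<sigma> \<kappa> \<xi> n \<theta> \<omega> =
     (\<Sum>\<^sub>\<infinity>j\<in>{1..}. \<kappa> n j * (\<theta> j + \<sigma> / sqrt (real n) * \<xi> j \<omega>)^2)
     - \<sigma>^2 / real n * rho \<kappa> n"

definition errI :: "'a measure \<Rightarrow> real \<Rightarrow> (nat \<Rightarrow> nat \<Rightarrow> real) \<Rightarrow> (nat \<Rightarrow> 'a \<Rightarrow> real)
    \<Rightarrow> nat \<Rightarrow> real \<Rightarrow> real" where
  "errI M \<sigma> \<kappa> \<xi> n t = measure M {\<omega> \<in> space M. Tstat \<sigma> \<kappa> \<xi> n (\<lambda>_. 0) \<omega> > t}"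

definition errII :: "'a measure \<Rightarrow> real \<Rightarrow> (nat \<Rightarrow> nat \<Rightarrow> real) \<Rightarrow> (nat \<Rightarrow> 'a \<Rightarrow> real)
    \<Rightarrow> nat \<Rightarrow> (nat \<Rightarrow> real) \<Rightarrow> real \<Rightarrow> real" where
  "errII M \<sigma> \<kappa> \<xi> n \<theta> t = measure M {\<omega> \<in> space M. Tstat \<sigma> \<kappa> \<xi> n \<theta> \<omega> \<le> t}"

(* the sequence g i (= f_{n_i}) at sample sizes ns i; tests given by thresholds t i *)
definition consistent :: "'a measure \<Rightarrow> real \<Rightarrow> (nat \<Rightarrow> nat \<Rightarrow> real) \<Rightarrow> (nat \<Rightarrow> 'a \<Rightarrow> real)
    \<Rightarrow> (nat \<Rightarrow> nat) \<Rightarrow> (nat \<Rightarrow> nat \<Rightarrow> real) \<Rightarrow> bool" where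
  "consistent M \<sigma> \<kappa> \<xi> ns g \<longleftrightarrow>
     (\<forall>\<alpha>::real. 0 < \<alpha> \<and> \<alpha> < 1 \<longrightarrow>
       (\<forall>t::nat \<Rightarrow> real.
          (\<lambda>i. errI M \<sigma> \<kappa> \<xi> (ns i) (t i)) \<longlonglongrightarrow> \<alpha> \<longrightarrow>
          limsup (\<lambda>i. ereal (errII M \<sigma> \<kappa> \<xi> (ns i) (g i) (t i))) < ereal (1 - \<alpha>)))"

definition inconsistent :: "'a measure \<Rightarrow> real \<Rightarrow> (nat \<Rightarrow> nat \<Rightarrow> real) \<Rightarrow> (nat \<Rightarrow> 'a \<Rightarrow> real)
    \<Rightarrow> (nat \<Rightarrow> nat) \<Rightarrow> (nat \<Rightarrow> nat \<Rightarrow> real) \<Rightarrow> bool" where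
  "inconsistent M \<sigma> \<kappa> \<xi> ns g \<longleftrightarrow>
     (\<forall>t::nat \<Rightarrow> real.
        liminf (\<lambda>i. ereal (errI M \<sigma> \<kappa> \<xi> (ns i) (t i) + errII M \<sigma> \<kappa> \<xi> (ns i) (g i) (t i))) \<ge> 1)"

definition r_consistent :: "'a measure \<Rightarrow> real \<Rightarrow> (nat \<Rightarrow> nat \<Rightarrow> real) \<Rightarrow> (nat \<Rightarrow> 'a \<Rightarrow> real)
    \<Rightarrow> real \<Rightarrow> (nat \<Rightarrow> nat \<Rightarrow> real) \<Rightarrow> bool" where
  "r_consistent M \<sigma> \<kappa> \<xi> r f \<longleftrightarrow>
     consistent M \<sigma> \<kappa> \<xi> id f \<and>
     (\<exists>c C. 0 < c \<and> c < C \<and> (\<forall>n\<ge>1. c * real n powr (-r) < l2norm (f n)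
                                      \<and> l2norm (f n) < C * real n powr (-r)))"

definition purely_r_consistent :: "'a measure \<Rightarrow> real \<Rightarrow> (nat \<Rightarrow> nat \<Rightarrow> real) \<Rightarrow> (nat \<Rightarrow> 'a \<Rightarrow> real)
    \<Rightarrow> real \<Rightarrow> (nat \<Rightarrow> nat \<Rightarrow> real) \<Rightarrow> bool" where
  "purely_r_consistent M \<sigma> \<kappa> \<xi> r f \<longleftrightarrow>
     r_consistent M \<sigma> \<kappa> \<xi> r f \<and>
     \<not> (\<exists>ns f2 c1. strict_mono ns \<and> (\<forall>i. 1 \<le> ns i) \<and> 0 < c1 \<and>
          (\<forall>i. ell2 (f2 i) \<and> l2inner (f2 i) (\<lambda>j. f (ns i) j - f2 i j) = 0
               \<and> l2norm (f2 i) > c1 * real (ns i) powr (-r)) \<and>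
          inconsistent M \<sigma> \<kappa> \<xi> ns f2)"

definition besov :: "real \<Rightarrow> real \<Rightarrow> (nat \<Rightarrow> real) set" where
  "besov s P0 = {\<theta>. \<forall>L::real. L > 0 \<longrightarrow>
        L powr (2 * s) * (\<Sum>\<^sub>\<infinity>j\<in>{j. 1 \<le> j \<and> real j > L}. (\<theta> j)^2) \<le> P0}"

end

theory Submission
  imports Defs
begin

text \<open>
  Standardising \<open>T\<^sub>n\<close> by its null standard deviation, which is of order \<open>n\<^sup>-\<^sup>2\<close>, makes it
  \<open>\<Sum> w\<^sub>j (\<xi>\<^sub>j\<^sup>2 - 1) + \<Sum> w\<^sub>j h\<^sub>j\<^sup>2 + 2 \<Sum> w\<^sub>j h\<^sub>j \<xi>\<^sub>j\<close>. The first term is asymptotically normal because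
  the largest weight tends to zero, and for the same reason the last one is negligible. Hence a
  sequence is detected if its signal-to-noise ratio \<open>\<Sum> w\<^sub>j h\<^sub>j\<^sup>2 \<asymp> n\<^sup>2 \<Sum> \<kappa>\<^sub>n\<^sub>j\<^sup>2 \<theta>\<^sub>n\<^sub>j\<^sup>2\<close> stays away from
  zero, and goes unnoticed if this ratio vanishes.

  The assumptions give \<open>k\<^sub>n \<asymp> n\<^sup>2\<^sup>-\<^sup>4\<^sup>r\<close> and \<open>\<kappa>\<^sub>n\<^sup>2 \<asymp> n\<^sup>2\<^sup>r\<^sup>-\<^sup>2\<close>, so a signal of norm \<open>n\<^sup>-\<^sup>r\<close> is visible if a
  fixed share of its energy sits at frequencies \<open>j \<le> a k\<^sub>n\<close> for some \<open>a\<close>. Both sides of the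
  equivalence say that \<open>f\<^sub>n\<close> is tight: its tails beyond \<open>a k\<^sub>n\<close> become small compared with \<open>n\<^sup>-\<^sup>r\<close>
  as \<open>a\<close> grows, uniformly in \<open>n\<close>. Since \<open>k\<^sub>n\<^sup>2\<^sup>s \<asymp> n\<^sup>2\<^sup>r\<close>, elements of a Besov ball have such tails, and
  conversely truncating a tight \<open>f\<^sub>n\<close> at \<open>a k\<^sub>n\<close> lands in a fixed Besov ball. If \<open>f\<^sub>n\<close> is tight, any
  large \<open>g \<bottom> f\<^sub>n - g\<close> correlates with \<open>f\<^sub>n\<close>, hence with its low frequencies, and is visible; if it
  is not, its tails along some subsequence form an invisible orthogonal part.
\<close>

section \<open>Continuous distribution functions\<close>

lemma isCont_cdf_density:
  assumes "real_distribution (density lborel f)" and [measurable]: "f \<in> borel_measurable borel"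
  shows "isCont (cdf (density lborel f)) x"
proof -
  interpret real_distribution "density lborel f" by fact
  have "emeasure (density lborel f) {x} = 0"
    by (simp add: emeasure_density)
  then show ?thesis by (simp add: isCont_cdf measure_def)
qed

lemma cdf_density_diff:
  assumes "real_distribution (density lborel f)" and [measurable]: "f \<in> borel_measurable borel"
    and "x \<le> y"
  shows "ennreal (cdf (density lborel f) y - cdf (density lborel f) x)
    = (\<integral>\<^sup>+z. f z * indicator {x<..y} z \<partial>lborel)"
proof (cases "x = y")
  case False
  interpret real_distribution "density lborel f" by fact
  have "ennreal (cdf (density lborel f) y - cdf (density lborel f) x)
    = emeasure (density lborel f) {x<..y}"
    using False \<open>x \<le> y\<close> by (simp add: cdf_diff_eq emeasure_eq_measure)
  then show ?thesis by (simp add: emeasure_density)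
qed simp

lemma cdf_density_diff_ge:
  fixes f :: "real \<Rightarrow> real"
  assumes "real_distribution (density lborel f)" "f \<in> borel_measurable borel" and "x \<le> y"
    and lower: "\<And>z. x < z \<Longrightarrow> z \<le> y \<Longrightarrow> c \<le> f z" and "0 \<le> c"
  shows "c * (y - x) \<le> cdf (density lborel f) y - cdf (density lborel f) x"
proof -
  interpret real_distribution "density lborel f" by fact
  have "ennreal (c * (y - x)) = (\<integral>\<^sup>+z. ennreal c * indicator {x<..y} z \<partial>lborel)"
    using \<open>x \<le> y\<close> \<open>0 \<le> c\<close> by (subst nn_integral_cmult_indicator) (auto simp: ennreal_mult'')
  also have "\<dots> \<le> (\<integral>\<^sup>+z. ennreal (f z) * indicator {x<..y} z \<partial>lborel)"
    using lower by (intro nn_integral_mono) (auto simp: indicator_def intro: ennreal_leI)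
  also have "\<dots> = ennreal (cdf (density lborel f) y - cdf (density lborel f) x)"
    using assms by (intro cdf_density_diff[symmetric]) auto
  finally show ?thesis using cdf_nondecreasing[OF \<open>x \<le> y\<close>] by (simp add: ennreal_le_iff)
qed

lemma cdf_density_diff_le:
  fixes f :: "real \<Rightarrow> real"
  assumes "real_distribution (density lborel f)" "f \<in> borel_measurable borel" and "x \<le> y"
    and upper: "\<And>z. x < z \<Longrightarrow> z \<le> y \<Longrightarrow> f z \<le> c" and "0 \<le> c"
  shows "cdf (density lborel f) y - cdf (density lborel f) x \<le> c * (y - x)"
proof -
  have "ennreal (cdf (density lborel f) y - cdf (density lborel f) x)
      = (\<integral>\<^sup>+z. ennreal (f z) * indicator {x<..y} z \<partial>lborel)"
    using assms by (intro cdf_density_diff) auto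
  also have "\<dots> \<le> (\<integral>\<^sup>+z. ennreal c * indicator {x<..y} z \<partial>lborel)"
    using upper by (intro nn_integral_mono) (auto simp: indicator_def intro: ennreal_leI)
  also have "\<dots> = ennreal (c * (y - x))"
    using \<open>x \<le> y\<close> \<open>0 \<le> c\<close> by (subst nn_integral_cmult_indicator) (auto simp: ennreal_mult'')
  finally show ?thesis using \<open>x \<le> y\<close> \<open>0 \<le> c\<close> by (simp add: ennreal_le_iff)
qed

lemma isCont_cdf_std_normal: "isCont (cdf std_normal_distribution) x"
  by (rule isCont_cdf_density[OF real_dist_normal_dist]) measurable

lemma cdf_std_normal_strict_mono: "strict_mono (cdf std_normal_distribution)"
proof (rule strict_monoI)
  fix x y :: real
  assume "x < y"
  define m where "m = max \<bar>x\<bar> \<bar>y\<bar>"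
  have "std_normal_density m \<le> std_normal_density z" if "x < z" "z \<le> y" for z
  proof -
    have "\<bar>z\<bar> \<le> \<bar>m\<bar>" using that by (auto simp: m_def)
    then have "z\<^sup>2 \<le> m\<^sup>2" by (simp add: abs_le_square_iff)
    then show ?thesis by (simp add: normal_density_def divide_right_mono)
  qed
  then have "std_normal_density m * (y - x)
      \<le> cdf std_normal_distribution y - cdf std_normal_distribution x"
    using \<open>x < y\<close> by (intro cdf_density_diff_ge real_dist_normal_dist) auto
  moreover have "0 < std_normal_density m * (y - x)"
    using \<open>x < y\<close> by (simp add: normal_density_pos)
  ultimately show "cdf std_normal_distribution x < cdf std_normal_distribution y" by simp
qed

lemma std_normal_density_le_1: "std_normal_density z \<le> 1"
proof -
  have "exp (- (z\<^sup>2 / 2)) \<le> 1" by simp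
  also have "1 \<le> sqrt (2 * pi)" using pi_gt3 by simp
  finally show ?thesis by (simp add: normal_density_def divide_simps)
qed

lemma cdf_std_normal_lipschitz:
  "x \<le> y \<Longrightarrow> cdf std_normal_distribution y - cdf std_normal_distribution x \<le> y - x"
  using cdf_density_diff_le[of std_normal_density x y 1] std_normal_density_le_1
    real_dist_normal_dist
  by simp

lemma obtain_grid_point_below:
  fixes p :: real and m :: nat
  assumes "0 < m" "p \<le> 1"
  obtains k :: nat where "k < m" "k = 0 \<or> k / m < p" "p - k / m \<le> 1 / m"
proof
  let ?k = "nat (\<lceil>m * p\<rceil> - 1)"
  have "m * p \<le> m" using assms by (simp add: mult_left_le)
  then have cell: "?k < m" "m * p \<le> ?k + 1" "?k = 0 \<or> ?k < m * p"
    using \<open>0 < m\<close> by linarith+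
  show "?k < m" by (rule cell(1))
  show "?k = 0 \<or> ?k / m < p" using cell(3) \<open>0 < m\<close> by (simp add: pos_divide_less_eq mult.commute)
  have "p \<le> (?k + 1) / m" using cell(2) \<open>0 < m\<close> by (simp add: pos_le_divide_eq mult.commute)
  then show "p - ?k / m \<le> 1 / m" by (simp add: add_divide_distrib)
qed

context real_distribution
begin

lemma obtain_quantile:
  assumes "\<And>x. isCont (cdf M) x" "0 < p" "p < 1"
  obtains x where "cdf M x = p"
proof -
  obtain a where below: "cdf M a < p"
    using order_tendstoD(2)[OF cdf_lim_at_bot \<open>0 < p\<close>]
    by (meson eventually_at_bot_linorder order_refl)
  obtain b where above: "p < cdf M b"
    using order_tendstoD(1)[OF cdf_lim_at_top_prob \<open>p < 1\<close>]
    by (meson eventually_at_top_linorder order_refl)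
  have "a \<le> b" using below above cdf_nondecreasing[of b a] by linarith
  then show thesis using IVT[of "cdf M" a p b] below above assms(1) that by auto
qed

lemma cdf_less_imp_less: "cdf M x < cdf M y \<Longrightarrow> x < y"
  using cdf_nondecreasing[of y x] by linarith

lemma obtain_quantile_grid:
  assumes cont: "\<And>x. isCont (cdf M) x" and "0 < \<epsilon>"
  obtains A where "finite A"
    "\<And>x. cdf M x \<le> \<epsilon> \<or> (\<exists>a\<in>A. a \<le> x \<and> cdf M x - cdf M a \<le> \<epsilon>)"
    "\<And>x. 1 - \<epsilon> \<le> cdf M x \<or> (\<exists>b\<in>A. x \<le> b \<and> cdf M b - cdf M x \<le> \<epsilon>)"
proof -
  obtain m :: nat where mesh: "0 < m" "1 / m < \<epsilon>"
    using reals_Archimedean[OF \<open>0 < \<epsilon>\<close>] by (metis inverse_eq_divide zero_less_Suc)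
  have "\<exists>x. cdf M x = k / m" if "k \<in> {1..<m}" for k :: nat
    using obtain_quantile[OF cont, of "k / m"] that by auto
  then obtain q where quantile: "cdf M (q k) = k / m" if "k \<in> {1..<m}" for k
    by metis
  show thesis
  proof (rule that[of "q ` {1..<m}"])
    fix x
    obtain k where lower_cell: "k < m" "k = 0 \<or> k / m < cdf M x" "cdf M x - k / m \<le> 1 / m"
      using obtain_grid_point_below[OF mesh(1) cdf_bounded_prob] by blast
    show "cdf M x \<le> \<epsilon> \<or> (\<exists>a\<in>q ` {1..<m}. a \<le> x \<and> cdf M x - cdf M a \<le> \<epsilon>)"
    proof (cases "k = 0")
      case False
      then have "k \<in> {1..<m}" "cdf M (q k) = k / m" using lower_cell(1) quantile by auto
      moreover from this have "q k \<le> x"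
        using cdf_less_imp_less[of "q k" x] lower_cell(2) False by simp
      ultimately show ?thesis using lower_cell(3) mesh(2) by force
    qed (use lower_cell(3) mesh(2) in simp)
    obtain l where upper_cell: "l < m" "l = 0 \<or> l / m < 1 - cdf M x" "1 - cdf M x - l / m \<le> 1 / m"
      using obtain_grid_point_below[OF mesh(1), of "1 - cdf M x"] cdf_nonneg[of x] by auto
    show "1 - \<epsilon> \<le> cdf M x \<or> (\<exists>b\<in>q ` {1..<m}. x \<le> b \<and> cdf M b - cdf M x \<le> \<epsilon>)"
    proof (cases "l = 0")
      case False
      then have "m - l \<in> {1..<m}" using upper_cell(1) by auto
      moreover from this have "cdf M (q (m - l)) = 1 - l / m"
        using quantile[of "m - l"] upper_cell(1) by (simp add: of_nat_diff diff_divide_distrib)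
      moreover from this have "x \<le> q (m - l)"
        using cdf_less_imp_less[of x "q (m - l)"] upper_cell(2) False by simp
      ultimately show ?thesis using upper_cell(3) mesh(2) by force
    qed (use upper_cell(3) mesh(2) in simp)
  qed simp
qed

lemma Polya_uniform_limit_cdf:
  assumes cont: "\<And>x. isCont (cdf M) x"
    and distribution: "\<And>n. mono (F n)" "\<And>n x. 0 \<le> F n x" "\<And>n x. F n x \<le> 1"
    and conv: "\<And>x. ((\<lambda>n. F n x) \<longlongrightarrow> cdf M x) net"
  shows "uniform_limit UNIV F (cdf M) net"
proof (rule uniform_limitI)
  fix \<epsilon> :: real
  assume "0 < \<epsilon>"
  then have "0 < \<epsilon> / 3" by simp
  with cont obtain A where grid: "finite A"
    "\<And>x. cdf M x \<le> \<epsilon> / 3 \<or> (\<exists>a\<in>A. a \<le> x \<and> cdf M x - cdf M a \<le> \<epsilon> / 3)"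
    "\<And>x. 1 - \<epsilon> / 3 \<le> cdf M x \<or> (\<exists>b\<in>A. x \<le> b \<and> cdf M b - cdf M x \<le> \<epsilon> / 3)"
    by (rule obtain_quantile_grid) blast
  have "\<forall>\<^sub>F n in net. \<forall>a\<in>A. \<bar>F n a - cdf M a\<bar> < \<epsilon> / 3"
    using tendstoD[OF conv \<open>0 < \<epsilon> / 3\<close>]
    by (intro eventually_ball_finite grid(1)) (simp add: dist_real_def)
  then show "\<forall>\<^sub>F n in net. \<forall>x\<in>UNIV. dist (F n x) (cdf M x) < \<epsilon>"
  proof eventually_elim
    case (elim n)
    have "cdf M x - \<epsilon> < F n x \<and> F n x < cdf M x + \<epsilon>" for x
    proof
      show "cdf M x - \<epsilon> < F n x"
        using grid(2)[of x]
      proof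
        assume "\<exists>a\<in>A. a \<le> x \<and> cdf M x - cdf M a \<le> \<epsilon> / 3"
        then obtain a where "a \<in> A" "a \<le> x" "cdf M x - cdf M a \<le> \<epsilon> / 3" by blast
        moreover have "\<bar>F n a - cdf M a\<bar> < \<epsilon> / 3" using elim \<open>a \<in> A\<close> by blast
        moreover have "F n a \<le> F n x" using distribution(1) \<open>a \<le> x\<close> by (rule monoD)
        ultimately show ?thesis using \<open>0 < \<epsilon>\<close> by linarith
      qed (use distribution(2)[of n x] \<open>0 < \<epsilon>\<close> in simp)
      show "F n x < cdf M x + \<epsilon>"
        using grid(3)[of x]
      proof
        assume "\<exists>b\<in>A. x \<le> b \<and> cdf M b - cdf M x \<le> \<epsilon> / 3"
        then obtain b where "b \<in> A" "x \<le> b" "cdf M b - cdf M x \<le> \<epsilon> / 3" by blast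
        moreover have "\<bar>F n b - cdf M b\<bar> < \<epsilon> / 3" using elim \<open>b \<in> A\<close> by blast
        moreover have "F n x \<le> F n b" using distribution(1) \<open>x \<le> b\<close> by (rule monoD)
        ultimately show ?thesis using \<open>0 < \<epsilon>\<close> by linarith
      qed (use distribution(3)[of n x] \<open>0 < \<epsilon>\<close> in simp)
    qed
    then show ?case by (simp add: dist_real_def abs_less_iff field_simps)
  qed
qed

end

section \<open>Linear forms in white noise\<close>

lemma abs_exp_minus_le_square:
  fixes u :: real
  assumes "0 \<le> u"
  shows "\<bar>exp (- u) - (1 - u)\<bar> \<le> u\<^sup>2"
proof -
  have "0 \<le> (1 - u)\<^sup>2 + u" using assms by simp
  then have pos: "0 \<le> 1 - u + u\<^sup>2" using assms by (simp add: power2_diff)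
  have "1 \<le> (1 - u + u\<^sup>2) * (1 + u)" using assms by (simp add: power2_eq_square algebra_simps)
  also have "\<dots> \<le> (1 - u + u\<^sup>2) * exp u"
    using exp_ge_add_one_self[of u] pos by (rule mult_left_mono)
  finally have "exp (- u) \<le> 1 - u + u\<^sup>2" by (simp add: exp_minus field_simps)
  moreover have "1 - u \<le> exp (- u)" using exp_ge_add_one_self[of "- u"] by simp
  ultimately show ?thesis by simp
qed

context prob_space
begin

lemma char_diff_gaussian_le:
  assumes [measurable]: "X \<in> borel_measurable M"
    and square: "integrable M (\<lambda>\<omega>. (X \<omega>)\<^sup>2)" and cube: "integrable M (\<lambda>\<omega>. \<bar>X \<omega>\<bar> ^ 3)"
    and mean: "expectation X = 0"
  defines "v \<equiv> expectation (\<lambda>\<omega>. (X \<omega>)\<^sup>2)"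
  shows "cmod (char (distr M borel X) t - exp (- (t\<^sup>2 * v / 2)))
    \<le> \<bar>t\<bar> ^ 3 * expectation (\<lambda>\<omega>. \<bar>X \<omega>\<bar> ^ 3) / 6 + (t\<^sup>2 * v / 2)\<^sup>2"
proof -
  have "0 \<le> v" unfolding v_def by simp
  have "integrable M X" using square by (rule square_integrable_imp_integrable[rotated]) measurable
  then have "cmod (char (distr M borel X) t - (1 - t\<^sup>2 * v / 2))
      \<le> t\<^sup>2 / 6 * expectation (\<lambda>\<omega>. min (6 * (X \<omega>)\<^sup>2) (\<bar>t\<bar> * \<bar>X \<omega>\<bar> ^ 3))"
    using square mean by (intro char_approx3') (auto simp: v_def)
  also have "\<dots> \<le> t\<^sup>2 / 6 * expectation (\<lambda>\<omega>. \<bar>t\<bar> * \<bar>X \<omega>\<bar> ^ 3)"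
    using square cube by (intro mult_left_mono integral_mono) auto
  also have "\<dots> = \<bar>t\<bar> ^ 3 * expectation (\<lambda>\<omega>. \<bar>X \<omega>\<bar> ^ 3) / 6"
    by (simp add: power3_eq_cube power2_eq_square)
  finally have taylor: "cmod (char (distr M borel X) t - (1 - t\<^sup>2 * v / 2))
      \<le> \<bar>t\<bar> ^ 3 * expectation (\<lambda>\<omega>. \<bar>X \<omega>\<bar> ^ 3) / 6" .
  have "cmod (complex_of_real (1 - t\<^sup>2 * v / 2) - exp (- (t\<^sup>2 * v / 2)))
      = \<bar>exp (- (t\<^sup>2 * v / 2)) - (1 - t\<^sup>2 * v / 2)\<bar>"
    by (metis abs_minus_commute norm_of_real of_real_diff)
  also have "\<dots> \<le> (t\<^sup>2 * v / 2)\<^sup>2"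
    using \<open>0 \<le> v\<close> by (intro abs_exp_minus_le_square) simp
  finally show ?thesis
    using taylor norm_triangle_ineq[of "char (distr M borel X) t - (1 - t\<^sup>2 * v / 2)"
        "complex_of_real (1 - t\<^sup>2 * v / 2) - exp (- (t\<^sup>2 * v / 2))"] by simp
qed

lemma char_distr_tendsto:
  assumes [measurable]: "\<And>m. X m \<in> borel_measurable M" "Y \<in> borel_measurable M"
    and conv: "AE \<omega> in M. (\<lambda>m. X m \<omega>) \<longlonglongrightarrow> Y \<omega>"
  shows "(\<lambda>m. char (distr M borel (X m)) t) \<longlonglongrightarrow> char (distr M borel Y) t"
proof -
  have "(\<lambda>m. CLINT \<omega>|M. iexp (t * X m \<omega>)) \<longlonglongrightarrow> (CLINT \<omega>|M. iexp (t * Y \<omega>))"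
  proof (rule integral_dominated_convergence[where w = "\<lambda>_. 1"])
    show "AE \<omega> in M. (\<lambda>m. iexp (t * X m \<omega>)) \<longlonglongrightarrow> iexp (t * Y \<omega>)"
      using conv by eventually_elim (intro tendsto_intros)
  qed auto
  then show ?thesis by (simp add: char_def integral_distr)
qed

lemma cdf_distr_le_shift:
  assumes [measurable]: "X \<in> borel_measurable M" "Y \<in> borel_measurable M"
  shows "cdf (distr M borel X) x
    \<le> cdf (distr M borel Y) (x - \<mu> + \<eta>) + prob {\<omega> \<in> space M. \<eta> \<le> \<bar>X \<omega> - Y \<omega> - \<mu>\<bar>}"
proof -
  have cdf: "cdf (distr M borel Z) y = prob {\<omega> \<in> space M. Z \<omega> \<le> y}"
    if "Z \<in> borel_measurable M" for Z y
    using that by (auto simp: cdf_def measure_distr intro!: arg_cong[where f = prob])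
  have "prob {\<omega> \<in> space M. X \<omega> \<le> x} \<le> prob ({\<omega> \<in> space M. Y \<omega> \<le> x - \<mu> + \<eta>}
      \<union> {\<omega> \<in> space M. \<eta> \<le> \<bar>X \<omega> - Y \<omega> - \<mu>\<bar>})"
    by (intro finite_measure_mono) auto
  also have "\<dots> \<le> prob {\<omega> \<in> space M. Y \<omega> \<le> x - \<mu> + \<eta>}
      + prob {\<omega> \<in> space M. \<eta> \<le> \<bar>X \<omega> - Y \<omega> - \<mu>\<bar>}"
    by (intro measure_Un_le) auto
  finally show ?thesis by (simp add: cdf)
qed

end

locale white_noise = prob_space +
  fixes Z :: "nat \<Rightarrow> 'a \<Rightarrow> real"
  assumes indep_Z: "indep_vars (\<lambda>_. borel) Z UNIV"
    and integrable_square: "\<And>j. integrable M (\<lambda>\<omega>. (Z j \<omega>)\<^sup>2)"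
    and mean_zero: "\<And>j. expectation (Z j) = 0"
    and unit_variance: "\<And>j. expectation (\<lambda>\<omega>. (Z j \<omega>)\<^sup>2) = 1"
begin

lemma noise_measurable [measurable]: "Z j \<in> borel_measurable M"
  using indep_Z unfolding indep_vars_def2 by simp

lemma expectation_product:
  "integrable M (\<lambda>\<omega>. Z j \<omega> * Z k \<omega>)"
  "expectation (\<lambda>\<omega>. Z j \<omega> * Z k \<omega>) = of_bool (j = k)"
proof -
  have "integrable M (\<lambda>\<omega>. Z j \<omega> * Z k \<omega>)
    \<and> expectation (\<lambda>\<omega>. Z j \<omega> * Z k \<omega>) = of_bool (j = k)"
  proof (cases "j = k")
    case True
    then show ?thesis using integrable_square unit_variance by (simp flip: power2_eq_square)
  next
    case False
    have integrable: "integrable M (Z i)" for i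
      using integrable_square by (rule square_integrable_imp_integrable[rotated]) measurable
    have indep: "indep_vars (\<lambda>_. borel) Z {j, k}"
      by (rule indep_vars_subset[OF indep_Z]) simp
    have "integrable M (\<lambda>\<omega>. \<Prod>i\<in>{j, k}. Z i \<omega>)"
      by (rule indep_vars_integrable[OF _ indep integrable]) simp
    moreover have "expectation (\<lambda>\<omega>. \<Prod>i\<in>{j, k}. Z i \<omega>) = (\<Prod>i\<in>{j, k}. expectation (Z i))"
      by (rule indep_vars_lebesgue_integral[OF _ indep integrable]) simp
    ultimately show ?thesis using False mean_zero by simp
  qed
  then show "integrable M (\<lambda>\<omega>. Z j \<omega> * Z k \<omega>)"
    "expectation (\<lambda>\<omega>. Z j \<omega> * Z k \<omega>) = of_bool (j = k)" by simp_all
qed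

lemma nn_integral_finite_linear_form_square:
  assumes "finite A"
  shows "(\<integral>\<^sup>+\<omega>. ennreal ((\<Sum>j\<in>A. c j * Z j \<omega>)\<^sup>2) \<partial>M) = ennreal (\<Sum>j\<in>A. (c j)\<^sup>2)"
proof -
  have expand: "(\<Sum>j\<in>A. c j * Z j \<omega>)\<^sup>2 = (\<Sum>j\<in>A. \<Sum>k\<in>A. (c j * c k) * (Z j \<omega> * Z k \<omega>))" for \<omega>
    by (simp add: power2_eq_square sum_product algebra_simps)
  have "integrable M (\<lambda>\<omega>. (\<Sum>j\<in>A. c j * Z j \<omega>)\<^sup>2)"
    unfolding expand
    by (intro Bochner_Integration.integrable_sum integrable_mult_right expectation_product)
  moreover have "expectation (\<lambda>\<omega>. (\<Sum>j\<in>A. c j * Z j \<omega>)\<^sup>2) = (\<Sum>j\<in>A. (c j)\<^sup>2)"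
    using assms unfolding expand
    by (simp add: Bochner_Integration.integral_sum Bochner_Integration.integrable_sum
        expectation_product power2_eq_square)
  ultimately show ?thesis by (subst nn_integral_eq_integral) auto
qed

definition linear_form :: "(nat \<Rightarrow> real) \<Rightarrow> ('a \<Rightarrow> real) \<Rightarrow> bool" where
  "linear_form c L \<longleftrightarrow> L \<in> borel_measurable M \<and> (AE \<omega> in M. (\<lambda>j. c j * Z j \<omega>) sums L \<omega>)"

lemma linear_form_square:
  assumes form: "linear_form c L" and summable: "summable (\<lambda>j. (c j)\<^sup>2)"
  shows "integrable M (\<lambda>\<omega>. (L \<omega>)\<^sup>2)" "expectation (\<lambda>\<omega>. (L \<omega>)\<^sup>2) \<le> (\<Sum>j. (c j)\<^sup>2)"
proof -
  have [measurable]: "L \<in> borel_measurable M"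
    and conv: "AE \<omega> in M. (\<lambda>j. c j * Z j \<omega>) sums L \<omega>"
    using form by (auto simp: linear_form_def)
  let ?S = "\<lambda>m \<omega>. \<Sum>j<m. c j * Z j \<omega>"
  have "(\<integral>\<^sup>+\<omega>. ennreal ((L \<omega>)\<^sup>2) \<partial>M) = (\<integral>\<^sup>+\<omega>. liminf (\<lambda>m. ennreal ((?S m \<omega>)\<^sup>2)) \<partial>M)"
  proof (rule nn_integral_cong_AE, use conv in eventually_elim)
    case (elim \<omega>)
    then have "(\<lambda>m. ennreal ((?S m \<omega>)\<^sup>2)) \<longlonglongrightarrow> ennreal ((L \<omega>)\<^sup>2)"
      by (intro tendsto_intros) (simp add: sums_def)
    then show ?case by (rule lim_imp_Liminf[OF trivial_limit_sequentially, symmetric])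
  qed
  also have "\<dots> \<le> liminf (\<lambda>m. \<integral>\<^sup>+\<omega>. ennreal ((?S m \<omega>)\<^sup>2) \<partial>M)"
    by (rule nn_integral_liminf) measurable
  also have "\<dots> \<le> ennreal (\<Sum>j. (c j)\<^sup>2)"
    unfolding nn_integral_finite_linear_form_square[OF finite_lessThan]
    using sum_le_suminf[OF summable] by (intro Liminf_le always_eventually allI ennreal_leI) auto
  finally have fatou: "(\<integral>\<^sup>+\<omega>. ennreal ((L \<omega>)\<^sup>2) \<partial>M) \<le> ennreal (\<Sum>j. (c j)\<^sup>2)" .
  then show "integrable M (\<lambda>\<omega>. (L \<omega>)\<^sup>2)"
    by (intro integrableI_bounded) (auto intro: le_less_trans[OF _ ennreal_less_top])
  then show "expectation (\<lambda>\<omega>. (L \<omega>)\<^sup>2) \<le> (\<Sum>j. (c j)\<^sup>2)"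
    using fatou
    by (subst (asm) nn_integral_eq_integral) (auto simp: ennreal_le_iff suminf_nonneg summable)
qed

lemma linear_form_tail_le:
  assumes form: "linear_form c L" and summable: "summable (\<lambda>j. (c j)\<^sup>2)" and "0 < \<eta>"
  shows "prob {\<omega> \<in> space M. \<eta> \<le> \<bar>L \<omega>\<bar>} \<le> (\<Sum>j. (c j)\<^sup>2) / \<eta>\<^sup>2"
proof -
  have "\<eta>\<^sup>2 \<le> (L \<omega>)\<^sup>2 \<longleftrightarrow> \<eta> \<le> \<bar>L \<omega>\<bar>" for \<omega>
    using \<open>0 < \<eta>\<close> by (metis abs_le_square_iff abs_of_pos)
  then have "prob {\<omega> \<in> space M. \<eta> \<le> \<bar>L \<omega>\<bar>} = prob {\<omega> \<in> space M. \<eta>\<^sup>2 \<le> (L \<omega>)\<^sup>2}" by simp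
  also have "\<dots> \<le> expectation (\<lambda>\<omega>. (L \<omega>)\<^sup>2) / \<eta>\<^sup>2"
    using \<open>0 < \<eta>\<close> linear_form_square(1)[OF form summable]
    by (intro integral_Markov_inequality_measure[where A = "{}"]) auto
  also have "\<dots> \<le> (\<Sum>j. (c j)\<^sup>2) / \<eta>\<^sup>2"
    using linear_form_square(2)[OF form summable] by (simp add: divide_right_mono)
  finally show ?thesis .
qed

end

locale white_noise_third_moment = white_noise +
  fixes \<beta> :: real
  assumes integrable_cube: "\<And>j. integrable M (\<lambda>\<omega>. \<bar>Z j \<omega>\<bar> ^ 3)"
    and third_moment_le: "\<And>j. expectation (\<lambda>\<omega>. \<bar>Z j \<omega>\<bar> ^ 3) \<le> \<beta>"
begin

lemma char_scaled_diff_gaussian_le: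
  "cmod (char (distr M borel (\<lambda>\<omega>. a * Z j \<omega>)) t - exp (- (t\<^sup>2 * a\<^sup>2 / 2)))
    \<le> \<bar>t\<bar> ^ 3 * \<bar>a\<bar> ^ 3 * \<beta> / 6 + (t\<^sup>2 * a\<^sup>2 / 2)\<^sup>2"
proof -
  have "cmod (char (distr M borel (\<lambda>\<omega>. a * Z j \<omega>)) t - exp (- (t\<^sup>2 * a\<^sup>2 / 2)))
      \<le> \<bar>t\<bar> ^ 3 * (\<bar>a\<bar> ^ 3 * expectation (\<lambda>\<omega>. \<bar>Z j \<omega>\<bar> ^ 3)) / 6 + (t\<^sup>2 * a\<^sup>2 / 2)\<^sup>2"
    using char_diff_gaussian_le[of "\<lambda>\<omega>. a * Z j \<omega>" t] integrable_square integrable_cube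
      mean_zero unit_variance by (simp add: power_mult_distrib abs_mult)
  also have "\<dots> \<le> \<bar>t\<bar> ^ 3 * (\<bar>a\<bar> ^ 3 * \<beta>) / 6 + (t\<^sup>2 * a\<^sup>2 / 2)\<^sup>2"
    using third_moment_le by (intro add_right_mono divide_right_mono mult_left_mono) auto
  finally show ?thesis by (simp add: mult.assoc)
qed

lemma char_finite_linear_form_diff_gaussian_le:
  assumes bounded: "\<And>j. \<bar>c j\<bar> \<le> b" and "finite A"
  shows "cmod (char (distr M borel (\<lambda>\<omega>. \<Sum>j\<in>A. c j * Z j \<omega>)) t - exp (- (t\<^sup>2 * (\<Sum>j\<in>A. (c j)\<^sup>2) / 2)))
    \<le> (\<bar>t\<bar> ^ 3 * \<beta> * b / 6 + t ^ 4 * b\<^sup>2 / 4) * (\<Sum>j\<in>A. (c j)\<^sup>2)"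
proof -
  let ?\<phi> = "\<lambda>j. char (distr M borel (\<lambda>\<omega>. c j * Z j \<omega>)) t"
    and ?\<gamma> = "\<lambda>j. complex_of_real (exp (- (t\<^sup>2 * (c j)\<^sup>2 / 2)))"
  have "char (distr M borel (\<lambda>\<omega>. \<Sum>j\<in>A. c j * Z j \<omega>)) t = (\<Prod>j\<in>A. ?\<phi> j)"
    by (rule char_distr_sum, rule indep_vars_compose2[where X = Z],
        rule indep_vars_subset[OF indep_Z]) auto
  moreover have "complex_of_real (exp (- (t\<^sup>2 * (\<Sum>j\<in>A. (c j)\<^sup>2) / 2))) = (\<Prod>j\<in>A. ?\<gamma> j)"
    using \<open>finite A\<close>
    by (simp add: exp_sum[symmetric] sum_distrib_left sum_divide_distrib sum_negf
        of_real_prod[symmetric] del: of_real_prod)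
  moreover have "cmod (?\<phi> j) \<le> 1" for j
    by (intro real_distribution.cmod_char_le_1 real_distribution_distr) auto
  ultimately have "cmod (char (distr M borel (\<lambda>\<omega>. \<Sum>j\<in>A. c j * Z j \<omega>)) t
      - exp (- (t\<^sup>2 * (\<Sum>j\<in>A. (c j)\<^sup>2) / 2))) \<le> (\<Sum>j\<in>A. cmod (?\<phi> j - ?\<gamma> j))"
    by (simp only:) (rule norm_prod_diff, auto simp del: of_real_exp)
  also have "\<dots> \<le> (\<Sum>j\<in>A. (\<bar>t\<bar> ^ 3 * \<beta> * b / 6 + t ^ 4 * b\<^sup>2 / 4) * (c j)\<^sup>2)"
  proof (rule sum_mono)
    fix j
    have "0 \<le> expectation (\<lambda>\<omega>. \<bar>Z j \<omega>\<bar> ^ 3)" by simp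
    then have "0 \<le> \<beta>" using third_moment_le[of j] by linarith
    have "\<bar>c j\<bar> ^ 3 \<le> b * (c j)\<^sup>2"
      using mult_right_mono[OF bounded[of j], of "(c j)\<^sup>2"]
      by (simp add: power3_eq_cube power2_eq_square)
    then have "\<bar>t\<bar> ^ 3 * \<beta> / 6 * \<bar>c j\<bar> ^ 3 \<le> \<bar>t\<bar> ^ 3 * \<beta> / 6 * (b * (c j)\<^sup>2)"
      using \<open>0 \<le> \<beta>\<close> by (intro mult_left_mono) auto
    moreover have "t ^ 4 / 4 * ((c j)\<^sup>2 * (c j)\<^sup>2) \<le> t ^ 4 / 4 * (b\<^sup>2 * (c j)\<^sup>2)"
      using bounded[of j]
      by (intro mult_left_mono mult_right_mono) (auto simp: abs_le_square_iff[symmetric])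
    moreover have "(t\<^sup>2 * (c j)\<^sup>2 / 2)\<^sup>2 = t ^ 4 / 4 * ((c j)\<^sup>2 * (c j)\<^sup>2)"
      by (simp add: power2_eq_square numeral_eq_Suc)
    ultimately show "cmod (?\<phi> j - ?\<gamma> j) \<le> (\<bar>t\<bar> ^ 3 * \<beta> * b / 6 + t ^ 4 * b\<^sup>2 / 4) * (c j)\<^sup>2"
      using char_scaled_diff_gaussian_le[of "c j" j t] by (simp add: algebra_simps)
  qed
  finally show ?thesis by (simp add: sum_distrib_left)
qed

lemma char_linear_form_diff_gaussian_le:
  assumes form: "linear_form c L" and coefficients: "\<And>j. \<bar>c j\<bar> \<le> b" "(\<lambda>j. (c j)\<^sup>2) sums 1"
  shows "cmod (char (distr M borel L) t - exp (- (t\<^sup>2) / 2))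
    \<le> \<bar>t\<bar> ^ 3 * \<beta> * b / 6 + t ^ 4 * b\<^sup>2 / 4"
proof -
  let ?S = "\<lambda>m \<omega>. \<Sum>j<m. c j * Z j \<omega>" and ?v = "\<lambda>m. \<Sum>j<m. (c j)\<^sup>2"
    and ?C = "\<bar>t\<bar> ^ 3 * \<beta> * b / 6 + t ^ 4 * b\<^sup>2 / 4"
  have variance: "?v \<longlonglongrightarrow> 1" using coefficients(2) by (simp add: sums_def)
  have "(\<lambda>m. char (distr M borel (?S m)) t) \<longlonglongrightarrow> char (distr M borel L) t"
    using form by (intro char_distr_tendsto) (auto simp: linear_form_def sums_def)
  moreover have "(\<lambda>m. complex_of_real (exp (- (t\<^sup>2 * ?v m / 2)))) \<longlonglongrightarrow> exp (- (t\<^sup>2 * 1 / 2))"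
    by (intro tendsto_intros variance) simp
  ultimately have "(\<lambda>m. cmod (char (distr M borel (?S m)) t - exp (- (t\<^sup>2 * ?v m / 2))))
      \<longlonglongrightarrow> cmod (char (distr M borel L) t - exp (- (t\<^sup>2 * 1 / 2)))"
    by (intro tendsto_norm tendsto_diff)
  moreover have "(\<lambda>m. ?C * ?v m) \<longlonglongrightarrow> ?C * 1" by (intro tendsto_intros variance)
  ultimately have "cmod (char (distr M borel L) t - exp (- (t\<^sup>2 * 1 / 2))) \<le> ?C * 1"
    by (rule LIMSEQ_le)
       (intro exI allI impI char_finite_linear_form_diff_gaussian_le coefficients(1)
        finite_lessThan)
  then show ?thesis by simp
qed

theorem linear_form_clt:
  assumes form: "\<And>n. linear_form (c n) (L n)"
    and coefficients: "\<And>n j. \<bar>c n j\<bar> \<le> b n" "\<And>n. (\<lambda>j. (c n j)\<^sup>2) sums 1"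
    and negligible: "b \<longlonglongrightarrow> 0"
  shows "weak_conv_m (\<lambda>n. distr M borel (L n)) std_normal_distribution"
proof (rule levy_continuity)
  fix t
  have "(\<lambda>n. \<bar>t\<bar> ^ 3 * \<beta> * b n / 6 + t ^ 4 * (b n)\<^sup>2 / 4) \<longlonglongrightarrow> \<bar>t\<bar> ^ 3 * \<beta> * 0 / 6 + t ^ 4 * 0\<^sup>2 / 4"
    by (intro tendsto_intros negligible) auto
  then have bound: "(\<lambda>n. \<bar>t\<bar> ^ 3 * \<beta> * b n / 6 + t ^ 4 * (b n)\<^sup>2 / 4) \<longlonglongrightarrow> 0" by simp
  have "(\<lambda>n. char (distr M borel (L n)) t - exp (- (t\<^sup>2) / 2)) \<longlonglongrightarrow> 0"
    using char_linear_form_diff_gaussian_le[OF form coefficients]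
    by (intro Lim_null_comparison[OF always_eventually bound]) blast
  then show "(\<lambda>n. char (distr M borel (L n)) t) \<longlonglongrightarrow> char std_normal_distribution t"
    by (subst Lim_null) (simp add: char_std_normal_distribution)
qed (use form in \<open>auto intro!: real_dist_normal_dist real_distribution_distr simp: linear_form_def\<close>)

end

section \<open>Quadratic forms in Gaussian noise\<close>

lemma summable_shifted_square:
  fixes w h x :: "nat \<Rightarrow> real"
  assumes nonneg: "\<And>j. 0 \<le> w j"
    and "summable (\<lambda>j. w j * (h j)\<^sup>2)" "summable (\<lambda>j. w j * (x j)\<^sup>2)"
  shows "summable (\<lambda>j. w j * (h j + x j)\<^sup>2)"
proof (rule summable_comparison_test')
  show "summable (\<lambda>j. 2 * (w j * (h j)\<^sup>2) + 2 * (w j * (x j)\<^sup>2))"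
    using assms by (intro summable_add summable_mult)
  have "(h j + x j)\<^sup>2 \<le> 2 * (h j)\<^sup>2 + 2 * (x j)\<^sup>2" for j
    using zero_le_power2[of "h j - x j"] by (simp add: power2_eq_square algebra_simps)
  from mult_left_mono[OF this nonneg]
  show "norm (w j * (h j + x j)\<^sup>2) \<le> 2 * (w j * (h j)\<^sup>2) + 2 * (w j * (x j)\<^sup>2)" for j
    using nonneg[of j] by (simp add: algebra_simps)
qed

locale gaussian_noise = prob_space +
  fixes \<xi> :: "nat \<Rightarrow> 'a \<Rightarrow> real"
  assumes indep_noise: "indep_vars (\<lambda>_. borel) \<xi> UNIV"
    and std_normal: "\<And>j. distributed M lborel (\<xi> j) std_normal_density"
begin

lemma integrable_noise_power: "integrable M (\<lambda>\<omega>. \<xi> j \<omega> ^ k)"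
  using integrable_std_normal_moment[of k]
    distributed_integrable[OF std_normal, of "\<lambda>x. x ^ k" j] by simp

lemma noise_even_moment: "expectation (\<lambda>\<omega>. \<xi> j \<omega> ^ (2 * k)) = fact (2 * k) / (2 ^ k * fact k)"
  using integral_std_normal_moment_even[of k]
    distributed_integral[OF std_normal, of "\<lambda>x. x ^ (2 * k)" j] by simp

lemma noise_moments:
  "expectation (\<lambda>\<omega>. \<xi> j \<omega> ^ 2) = 1"
  "expectation (\<lambda>\<omega>. \<xi> j \<omega> ^ 4) = 3"
  "expectation (\<lambda>\<omega>. \<xi> j \<omega> ^ 6) = 15"
  using noise_even_moment[of j 1] noise_even_moment[of j 2] noise_even_moment[of j 3]
  by (simp_all add: fact_numeral)

sublocale white_noise M \<xi>
  using indep_noise integrable_noise_power[of _ 2] noise_moments(1)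
    standard_normal_distributed_expectation[OF std_normal]
  by unfold_locales auto

definition chi :: "nat \<Rightarrow> 'a \<Rightarrow> real" where
  "chi j \<omega> = ((\<xi> j \<omega>)\<^sup>2 - 1) / sqrt 2"

lemma chi_measurable [measurable]: "chi j \<in> borel_measurable M"
  unfolding chi_def by measurable

lemma chi_mean: "expectation (chi j) = 0"
  using integrable_noise_power[of j 2] noise_moments(1)[of j] prob_space unfolding chi_def by simp

lemma chi_square:
  "integrable M (\<lambda>\<omega>. (chi j \<omega>)\<^sup>2)" "expectation (\<lambda>\<omega>. (chi j \<omega>)\<^sup>2) = 1"
proof -
  have expand: "(chi j \<omega>)\<^sup>2 = (\<xi> j \<omega> ^ 4 - 2 * \<xi> j \<omega> ^ 2 + 1) / 2" for \<omega>
    by (simp add: chi_def power2_eq_square algebra_simps numeral_eq_Suc)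
  show "integrable M (\<lambda>\<omega>. (chi j \<omega>)\<^sup>2)" "expectation (\<lambda>\<omega>. (chi j \<omega>)\<^sup>2) = 1"
    unfolding expand using integrable_noise_power[of j] noise_moments[of j] prob_space by auto
qed

lemma chi_cube:
  "integrable M (\<lambda>\<omega>. \<bar>chi j \<omega>\<bar> ^ 3)" "expectation (\<lambda>\<omega>. \<bar>chi j \<omega>\<bar> ^ 3) \<le> 28"
proof -
  have cube_le: "\<bar>chi j \<omega>\<bar> ^ 3 \<le> \<xi> j \<omega> ^ 6 + 3 * \<xi> j \<omega> ^ 4 + 3 * \<xi> j \<omega> ^ 2 + 1" for \<omega>
  proof -
    have "\<bar>chi j \<omega>\<bar> \<le> \<bar>(\<xi> j \<omega>)\<^sup>2 - 1\<bar>"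
      using divide_left_mono[of 1 "sqrt 2" "\<bar>(\<xi> j \<omega>)\<^sup>2 - 1\<bar>"] by (simp add: chi_def)
    also have "\<dots> \<le> (\<xi> j \<omega>)\<^sup>2 + 1" by (simp add: abs_le_iff)
    finally have "\<bar>chi j \<omega>\<bar> ^ 3 \<le> ((\<xi> j \<omega>)\<^sup>2 + 1) ^ 3" by (intro power_mono) auto
    also have "\<dots> = \<xi> j \<omega> ^ 6 + 3 * \<xi> j \<omega> ^ 4 + 3 * \<xi> j \<omega> ^ 2 + 1"
      by (simp add: power2_eq_square algebra_simps numeral_eq_Suc)
    finally show ?thesis .
  qed
  have integrable: "integrable M (\<lambda>\<omega>. \<xi> j \<omega> ^ 6 + 3 * \<xi> j \<omega> ^ 4 + 3 * \<xi> j \<omega> ^ 2 + 1)"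
    using integrable_noise_power[of j] by auto
  show "integrable M (\<lambda>\<omega>. \<bar>chi j \<omega>\<bar> ^ 3)"
    by (rule Bochner_Integration.integrable_bound[OF integrable])
       (auto intro!: AE_I2 order_trans[OF cube_le])
  then have "expectation (\<lambda>\<omega>. \<bar>chi j \<omega>\<bar> ^ 3)
      \<le> expectation (\<lambda>\<omega>. \<xi> j \<omega> ^ 6 + 3 * \<xi> j \<omega> ^ 4 + 3 * \<xi> j \<omega> ^ 2 + 1)"
    using integrable cube_le by (intro integral_mono) auto
  also have "\<dots> = 28"
    using integrable_noise_power[of j] noise_moments[of j] prob_space by simp
  finally show "expectation (\<lambda>\<omega>. \<bar>chi j \<omega>\<bar> ^ 3) \<le> 28" .
qed

sublocale chi: white_noise_third_moment M chi 28
proof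
  show "indep_vars (\<lambda>_. borel) chi UNIV"
    unfolding chi_def by (rule indep_vars_compose2[OF indep_noise]) measurable
qed (rule chi_mean chi_square chi_cube)+

text \<open>On a divergent sum \<^const>\<open>enn2real\<close> gives 0, the same junk value as \<^const>\<open>infsum\<close>, and it makes
  measurability immediate.\<close>

definition quad :: "(nat \<Rightarrow> real) \<Rightarrow> (nat \<Rightarrow> real) \<Rightarrow> 'a \<Rightarrow> real" where
  "quad w h \<omega> = enn2real (\<Sum>j. ennreal (w j * (h j + \<xi> j \<omega>)\<^sup>2)) - (\<Sum>j. w j)"

definition quad_distr :: "(nat \<Rightarrow> real) \<Rightarrow> (nat \<Rightarrow> real) \<Rightarrow> real measure" where
  "quad_distr w h = distr M borel (quad w h)"

definition noncentrality :: "(nat \<Rightarrow> real) \<Rightarrow> (nat \<Rightarrow> real) \<Rightarrow> real" where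
  "noncentrality w h = (\<Sum>j. w j * (h j)\<^sup>2)"

lemma quad_measurable [measurable]: "quad w h \<in> borel_measurable M"
  unfolding quad_def by measurable

sublocale quad_distr: real_distribution "quad_distr w h" for w h
  unfolding quad_distr_def by (rule real_distribution_distr) measurable

lemma cdf_quad_distr: "cdf (quad_distr w h) x = prob {\<omega> \<in> space M. quad w h \<omega> \<le> x}"
  by (auto simp: quad_distr_def cdf_def measure_distr intro!: arg_cong[where f = prob])

lemma quad_eq_suminf:
  assumes "\<And>j. 0 \<le> w j" "summable (\<lambda>j. w j * (h j + \<xi> j \<omega>)\<^sup>2)"
  shows "quad w h \<omega> = (\<Sum>j. w j * (h j + \<xi> j \<omega>)\<^sup>2) - (\<Sum>j. w j)"
  using assms unfolding quad_def by (simp add: suminf_ennreal2 suminf_nonneg)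

lemma AE_summable_weighted_square:
  assumes "\<And>j. 0 \<le> w j" "summable w"
  shows "AE \<omega> in M. summable (\<lambda>j. w j * (\<xi> j \<omega>)\<^sup>2)"
proof -
  have "(\<integral>\<^sup>+\<omega>. ennreal (w j * (\<xi> j \<omega>)\<^sup>2) \<partial>M) = ennreal (w j)" for j
    using integrable_square unit_variance assms(1) by (subst nn_integral_eq_integral) auto
  then have "(\<integral>\<^sup>+\<omega>. (\<Sum>j. ennreal (w j * (\<xi> j \<omega>)\<^sup>2)) \<partial>M) = (\<Sum>j. ennreal (w j))"
    by (subst nn_integral_suminf) auto
  also have "\<dots> \<noteq> \<infinity>"
    unfolding infinity_ennreal_def by (rule ennreal_suminf_neq_top) fact+
  finally have "AE \<omega> in M. (\<Sum>j. ennreal (w j * (\<xi> j \<omega>)\<^sup>2)) \<noteq> \<infinity>"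
    by (intro nn_integral_PInf_AE) auto
  then show ?thesis
    using assms(1) by (auto elim!: eventually_mono intro: summable_suminf_not_top)
qed

lemma quad_null_linear_form:
  assumes weights: "\<And>j. 0 \<le> w j" "summable w"
  shows "chi.linear_form (\<lambda>j. sqrt 2 * w j) (quad w (\<lambda>_. 0))"
  unfolding chi.linear_form_def
proof (intro conjI)
  show "AE \<omega> in M. (\<lambda>j. sqrt 2 * w j * chi j \<omega>) sums quad w (\<lambda>_. 0) \<omega>"
    using AE_summable_weighted_square[OF weights]
  proof eventually_elim
    case (elim \<omega>)
    have "(\<lambda>j. w j * (\<xi> j \<omega>)\<^sup>2 - w j) sums ((\<Sum>j. w j * (\<xi> j \<omega>)\<^sup>2) - (\<Sum>j. w j))"
      using elim weights(2) by (intro sums_diff summable_sums)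
    also have "\<dots> = quad w (\<lambda>_. 0) \<omega>"
      using quad_eq_suminf[of w "\<lambda>_. 0" \<omega>] weights elim by simp
    also have "(\<lambda>j. w j * (\<xi> j \<omega>)\<^sup>2 - w j) = (\<lambda>j. w j * ((\<xi> j \<omega>)\<^sup>2 - 1))"
      by (simp add: right_diff_distrib)
    also have "\<dots> = (\<lambda>j. sqrt 2 * w j * chi j \<omega>)" by (simp add: chi_def)
    finally show ?case .
  qed
qed measurable

lemma quad_diff_null_linear_form:
  assumes weights: "\<And>j. 0 \<le> w j" "summable w" and signal: "summable (\<lambda>j. w j * (h j)\<^sup>2)"
  shows "linear_form (\<lambda>j. 2 * w j * h j)
    (\<lambda>\<omega>. quad w h \<omega> - quad w (\<lambda>_. 0) \<omega> - noncentrality w h)"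
  unfolding linear_form_def
proof (intro conjI)
  show "AE \<omega> in M. (\<lambda>j. 2 * w j * h j * \<xi> j \<omega>)
      sums (quad w h \<omega> - quad w (\<lambda>_. 0) \<omega> - noncentrality w h)"
    using AE_summable_weighted_square[OF weights]
  proof eventually_elim
    case (elim \<omega>)
    have shifted: "summable (\<lambda>j. w j * (h j + \<xi> j \<omega>)\<^sup>2)"
      by (rule summable_shifted_square[OF weights(1) signal elim])
    have "(\<lambda>j. w j * (h j + \<xi> j \<omega>)\<^sup>2 - w j * (\<xi> j \<omega>)\<^sup>2 - w j * (h j)\<^sup>2) sums
        ((\<Sum>j. w j * (h j + \<xi> j \<omega>)\<^sup>2) - (\<Sum>j. w j * (\<xi> j \<omega>)\<^sup>2) - noncentrality w h)"
      unfolding noncentrality_def using elim shifted signal by (intro sums_diff summable_sums)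
    also have "\<dots> = quad w h \<omega> - quad w (\<lambda>_. 0) \<omega> - noncentrality w h"
      using quad_eq_suminf[of w h \<omega>] quad_eq_suminf[of w "\<lambda>_. 0" \<omega>] weights(1) elim shifted by simp
    also have "(\<lambda>j. w j * (h j + \<xi> j \<omega>)\<^sup>2 - w j * (\<xi> j \<omega>)\<^sup>2 - w j * (h j)\<^sup>2)
        = (\<lambda>j. 2 * w j * h j * \<xi> j \<omega>)"
      by (simp add: fun_eq_iff power2_eq_square algebra_simps)
    finally show ?case .
  qed
qed measurable

lemma quad_diff_null_tail_le:
  assumes weights: "\<And>j. 0 \<le> w j" "summable w" "\<And>j. w j \<le> b"
    and signal: "summable (\<lambda>j. w j * (h j)\<^sup>2)" and "0 < \<eta>"
  shows "prob {\<omega> \<in> space M. \<eta> \<le> \<bar>quad w h \<omega> - quad w (\<lambda>_. 0) \<omega> - noncentrality w h\<bar>}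
    \<le> 4 * b * noncentrality w h / \<eta>\<^sup>2"
proof -
  have square_le: "(2 * w j * h j)\<^sup>2 \<le> 4 * b * (w j * (h j)\<^sup>2)" for j
  proof -
    have "w j * (4 * (w j * (h j)\<^sup>2)) \<le> b * (4 * (w j * (h j)\<^sup>2))"
      using weights(1)[of j] by (intro mult_right_mono weights(3)) auto
    then show ?thesis by (simp add: power2_eq_square algebra_simps)
  qed
  have summable_square: "summable (\<lambda>j. (2 * w j * h j)\<^sup>2)"
    by (rule summable_comparison_test'[OF summable_mult[OF signal, of "4 * b"]])
       (use square_le in auto)
  have "(\<Sum>j. (2 * w j * h j)\<^sup>2) \<le> (\<Sum>j. 4 * b * (w j * (h j)\<^sup>2))"
    by (intro suminf_le square_le summable_square summable_mult signal)
  also have "\<dots> = 4 * b * noncentrality w h"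
    unfolding noncentrality_def by (rule suminf_mult[OF signal])
  finally show ?thesis
    using linear_form_tail_le[OF quad_diff_null_linear_form[OF weights(1,2) signal]
        summable_square \<open>0 < \<eta>\<close>]
    by (meson divide_right_mono order_trans zero_le_power2)
qed

lemma cdf_quad_distr_shift:
  assumes "\<And>j. 0 \<le> w j" "summable w" "\<And>j. w j \<le> b"
    and "summable (\<lambda>j. w j * (h j)\<^sup>2)" and "0 < \<eta>"
  shows "cdf (quad_distr w h) x
      \<le> cdf (quad_distr w (\<lambda>_. 0)) (x - noncentrality w h + \<eta>) + 4 * b * noncentrality w h / \<eta>\<^sup>2"
    and "cdf (quad_distr w (\<lambda>_. 0)) (x - noncentrality w h - \<eta>)
      \<le> cdf (quad_distr w h) x + 4 * b * noncentrality w h / \<eta>\<^sup>2"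
proof -
  note tail_le = quad_diff_null_tail_le[OF assms]
  show "cdf (quad_distr w h) x
      \<le> cdf (quad_distr w (\<lambda>_. 0)) (x - noncentrality w h + \<eta>) + 4 * b * noncentrality w h / \<eta>\<^sup>2"
    using cdf_distr_le_shift[of "quad w h" "quad w (\<lambda>_. 0)" x "noncentrality w h" \<eta>] tail_le
    by (simp add: quad_distr_def)
  have swap: "\<bar>quad w (\<lambda>_. 0) \<omega> - quad w h \<omega> - - noncentrality w h\<bar>
      = \<bar>quad w h \<omega> - quad w (\<lambda>_. 0) \<omega> - noncentrality w h\<bar>" for \<omega> by simp
  show "cdf (quad_distr w (\<lambda>_. 0)) (x - noncentrality w h - \<eta>)
      \<le> cdf (quad_distr w h) x + 4 * b * noncentrality w h / \<eta>\<^sup>2"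
    using cdf_distr_le_shift[of "quad w (\<lambda>_. 0)" "quad w h" "x - noncentrality w h - \<eta>"
        "- noncentrality w h" \<eta>] tail_le
    unfolding swap by (simp add: quad_distr_def)
qed

end

locale negligible_weights = gaussian_noise +
  fixes w :: "nat \<Rightarrow> nat \<Rightarrow> real" and b :: "nat \<Rightarrow> real"
  assumes weight_nonneg: "\<And>i j. 0 \<le> w i j" and weight_summable: "\<And>i. summable (w i)"
    and weight_normalised: "\<And>i. (\<lambda>j. (w i j)\<^sup>2) sums (1 / 2)"
    and weight_le: "\<And>i j. w i j \<le> b i" and bound_tendsto_0: "b \<longlonglongrightarrow> 0"
begin

lemma bound_nonneg: "0 \<le> b i"
  using weight_nonneg weight_le order_trans by blast

lemma noncentrality_nonneg: "summable (\<lambda>j. w i j * (h j)\<^sup>2) \<Longrightarrow> 0 \<le> noncentrality (w i) h"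
  unfolding noncentrality_def by (intro suminf_nonneg mult_nonneg_nonneg weight_nonneg) auto

lemma cdf_null_tendsto:
  "(\<lambda>i. cdf (quad_distr (w i) (\<lambda>_. 0)) x) \<longlonglongrightarrow> cdf std_normal_distribution x"
proof -
  have "weak_conv_m (\<lambda>i. distr M borel (quad (w i) (\<lambda>_. 0))) std_normal_distribution"
  proof (rule chi.linear_form_clt)
    show "chi.linear_form (\<lambda>j. sqrt 2 * w i j) (quad (w i) (\<lambda>_. 0))" for i
      by (rule quad_null_linear_form[OF weight_nonneg weight_summable])
    show "\<bar>sqrt 2 * w i j\<bar> \<le> sqrt 2 * b i" for i j
      using weight_nonneg weight_le by (simp add: abs_mult)
    show "(\<lambda>j. (sqrt 2 * w i j)\<^sup>2) sums 1" for i
      using sums_mult[OF weight_normalised[of i], of 2] by (simp add: power_mult_distrib)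
    show "(\<lambda>i. sqrt 2 * b i) \<longlonglongrightarrow> 0"
      using tendsto_mult_left[OF bound_tendsto_0, of "sqrt 2"] by simp
  qed
  then show ?thesis
    using isCont_cdf_std_normal by (simp add: weak_conv_m_def weak_conv_def quad_distr_def)
qed

lemma threshold_eventually_less:
  assumes null: "(\<lambda>i. cdf (quad_distr (w i) (\<lambda>_. 0)) (x i)) \<longlonglongrightarrow> p"
    and "p < cdf std_normal_distribution y"
  shows "\<forall>\<^sub>F i in sequentially. x i < y"
proof -
  obtain p' where between: "p < p'" "p' < cdf std_normal_distribution y"
    using dense assms(2) by blast
  show ?thesis
    using order_tendstoD(2)[OF null between(1)] order_tendstoD(1)[OF cdf_null_tendsto between(2)]
  proof eventually_elim
    case (elim i)
    then have "cdf (quad_distr (w i) (\<lambda>_. 0)) (x i) < cdf (quad_distr (w i) (\<lambda>_. 0)) y"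
      by linarith
    then show ?case by (rule quad_distr.cdf_less_imp_less)
  qed
qed

text \<open>The choice \<open>\<eta> = \<mu>\<^sub>i / 2\<close> in the shift bound makes its error term \<open>16 b\<^sub>i / \<mu>\<^sub>i\<close>, so no upper
  bound on the noncentrality \<open>\<mu>\<^sub>i\<close> is needed.\<close>

lemma detectable_if_noncentrality_bounded_below:
  assumes signal: "\<And>i. summable (\<lambda>j. w i j * (h i j)\<^sup>2)"
    and lower: "0 < a" "\<And>i. a \<le> noncentrality (w i) (h i)"
    and unit: "0 < p" "p < 1" and null: "(\<lambda>i. cdf (quad_distr (w i) (\<lambda>_. 0)) (x i)) \<longlonglongrightarrow> p"
  obtains q where "q < p" "\<forall>\<^sub>F i in sequentially. cdf (quad_distr (w i) (h i)) (x i) \<le> q"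
proof -
  let ?\<Phi> = "cdf std_normal_distribution" and ?\<mu> = "\<lambda>i. noncentrality (w i) (h i)"
  note strict_mono = cdf_std_normal_strict_mono[THEN strict_monoD]
  obtain z where quantile: "?\<Phi> z = p"
    using real_distribution.obtain_quantile[OF real_dist_normal_dist isCont_cdf_std_normal unit] .
  have threshold: "\<forall>\<^sub>F i in sequentially. x i < z + a / 4"
    using strict_mono[of z "z + a / 4"] quantile lower(1)
    by (intro threshold_eventually_less[OF null]) simp
  obtain q where between: "?\<Phi> (z - a / 4) < q" "q < p"
    using dense[of "?\<Phi> (z - a / 4)" p] strict_mono[of "z - a / 4" z] quantile lower(1) by auto
  have "(\<lambda>i. cdf (quad_distr (w i) (\<lambda>_. 0)) (z - a / 4) + 16 * b i / a)
      \<longlonglongrightarrow> ?\<Phi> (z - a / 4) + 16 * 0 / a"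
    using lower(1) by (intro tendsto_intros cdf_null_tendsto bound_tendsto_0) simp
  then have "\<forall>\<^sub>F i in sequentially. cdf (quad_distr (w i) (\<lambda>_. 0)) (z - a / 4) + 16 * b i / a < q"
    using between(1) by (intro order_tendstoD) auto
  with threshold have "\<forall>\<^sub>F i in sequentially. cdf (quad_distr (w i) (h i)) (x i) \<le> q"
  proof eventually_elim
    case (elim i)
    have pos: "0 < ?\<mu> i" using lower(1) lower(2)[of i] by simp
    then have "cdf (quad_distr (w i) (h i)) (x i)
        \<le> cdf (quad_distr (w i) (\<lambda>_. 0)) (x i - ?\<mu> i + ?\<mu> i / 2) + 4 * b i * ?\<mu> i / (?\<mu> i / 2)\<^sup>2"
      by (intro cdf_quad_distr_shift weight_nonneg weight_summable weight_le signal) simp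
    also have "4 * b i * ?\<mu> i / (?\<mu> i / 2)\<^sup>2 = 16 * b i / ?\<mu> i"
      using pos by (simp add: power2_eq_square field_simps)
    also have "cdf (quad_distr (w i) (\<lambda>_. 0)) (x i - ?\<mu> i + ?\<mu> i / 2) + 16 * b i / ?\<mu> i
        \<le> cdf (quad_distr (w i) (\<lambda>_. 0)) (z - a / 4) + 16 * b i / a"
      using elim(1) lower(1) lower(2)[of i] bound_nonneg[of i]
      by (intro add_mono quad_distr.cdf_nondecreasing divide_left_mono) auto
    finally show ?case using elim(2) by simp
  qed
  with between(2) show thesis using that by blast
qed

lemma undetectable_if_noncentrality_vanishes:
  assumes signal: "\<And>i. summable (\<lambda>j. w i j * (h i j)\<^sup>2)"
    and vanishing: "(\<lambda>i. noncentrality (w i) (h i)) \<longlonglongrightarrow> 0" and "0 < \<epsilon>"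
  shows "\<forall>\<^sub>F i in sequentially. \<forall>x.
    cdf (quad_distr (w i) (\<lambda>_. 0)) x - cdf (quad_distr (w i) (h i)) x \<le> \<epsilon>"
proof -
  let ?\<Phi> = "cdf std_normal_distribution" and ?\<mu> = "\<lambda>i. noncentrality (w i) (h i)"
    and ?\<eta> = "\<epsilon> / 5" and ?F = "\<lambda>i. cdf (quad_distr (w i) (\<lambda>_. 0))"
  have "uniform_limit UNIV ?F ?\<Phi> sequentially"
    by (intro real_distribution.Polya_uniform_limit_cdf real_dist_normal_dist isCont_cdf_std_normal
        monoI quad_distr.cdf_nondecreasing quad_distr.cdf_nonneg quad_distr.cdf_bounded_prob
        cdf_null_tendsto)
  then have uniform: "\<forall>\<^sub>F i in sequentially. \<forall>x. \<bar>?F i x - ?\<Phi> x\<bar> < ?\<eta>"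
    using \<open>0 < \<epsilon>\<close> by (auto simp: uniform_limit_iff dist_real_def dest: spec[of _ ?\<eta>])
  have "(\<lambda>i. ?\<mu> i + 4 * b i * ?\<mu> i / ?\<eta>\<^sup>2) \<longlonglongrightarrow> 0 + 4 * 0 * 0 / ?\<eta>\<^sup>2"
    using \<open>0 < \<epsilon>\<close> by (intro tendsto_intros bound_tendsto_0 vanishing) simp
  then have small: "\<forall>\<^sub>F i in sequentially. ?\<mu> i + 4 * b i * ?\<mu> i / ?\<eta>\<^sup>2 < ?\<eta>"
    by (rule order_tendstoD(2)) (use \<open>0 < \<epsilon>\<close> in simp)
  show ?thesis
    using uniform small
  proof eventually_elim
    case (elim i)
    show ?case
    proof
      fix x
      let ?y = "x - ?\<mu> i - ?\<eta>"
      have "?\<Phi> x - ?\<Phi> ?y \<le> ?\<mu> i + ?\<eta>"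
        using cdf_std_normal_lipschitz[of ?y x] noncentrality_nonneg[OF signal, of i] \<open>0 < \<epsilon>\<close>
        by simp
      moreover have "\<bar>?F i x - ?\<Phi> x\<bar> < ?\<eta>" "\<bar>?F i ?y - ?\<Phi> ?y\<bar> < ?\<eta>"
        using elim(1) by blast+
      moreover have "?F i ?y \<le> cdf (quad_distr (w i) (h i)) x + 4 * b i * ?\<mu> i / ?\<eta>\<^sup>2"
        using \<open>0 < \<epsilon>\<close>
        by (intro cdf_quad_distr_shift weight_nonneg weight_summable weight_le signal) simp
      ultimately show "?F i x - cdf (quad_distr (w i) (h i)) x \<le> \<epsilon>"
        using elim(2) by linarith
    qed
  qed
qed

end

section \<open>Square summable sequences\<close>

lemma summable_on_atLeast1_iff:
  fixes f :: "nat \<Rightarrow> real"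
  assumes "\<And>j. 1 \<le> j \<Longrightarrow> 0 \<le> f j"
  shows "f summable_on {1..} \<longleftrightarrow> summable (\<lambda>j. of_bool (1 \<le> j) * f j)"
proof -
  have "f summable_on {1..} \<longleftrightarrow> (\<lambda>j. of_bool (1 \<le> j) * f j) summable_on UNIV"
    by (rule summable_on_cong_neutral) auto
  then show ?thesis using assms by (subst (asm) summable_on_UNIV_nonneg_real_iff) auto
qed

lemma sums_infsum_atLeast1:
  fixes f :: "nat \<Rightarrow> real"
  assumes "f summable_on {1..}"
  shows "(\<lambda>j. of_bool (1 \<le> j) * f j) sums infsum f {1..}"
proof -
  have "((\<lambda>j. of_bool (1 \<le> j) * f j) has_sum infsum f {1..}) UNIV
      \<longleftrightarrow> (f has_sum infsum f {1..}) {1..}"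
    by (rule has_sum_cong_neutral) auto
  then show ?thesis using assms by (intro has_sum_imp_sums) simp
qed

lemma infsum_atLeast1_eq_enn2real:
  fixes f :: "nat \<Rightarrow> real"
  assumes nonneg: "\<And>j. 1 \<le> j \<Longrightarrow> 0 \<le> f j"
  shows "infsum f {1..} = enn2real (\<Sum>j. ennreal (of_bool (1 \<le> j) * f j))"
proof (cases "f summable_on {1..}")
  case True
  then have "(\<lambda>j. of_bool (1 \<le> j) * f j) sums infsum f {1..}" by (rule sums_infsum_atLeast1)
  then have "(\<Sum>j. ennreal (of_bool (1 \<le> j) * f j)) = ennreal (infsum f {1..})"
    using nonneg by (subst suminf_ennreal2) (auto simp: sums_iff)
  moreover have "0 \<le> infsum f {1..}" using nonneg by (intro infsum_nonneg) auto
  ultimately show ?thesis by simp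
next
  case False
  have "(\<Sum>j. ennreal (of_bool (1 \<le> j) * f j)) = top"
  proof (rule ccontr)
    assume "(\<Sum>j. ennreal (of_bool (1 \<le> j) * f j)) \<noteq> top"
    then have "summable (\<lambda>j. of_bool (1 \<le> j) * f j)"
      using nonneg by (intro summable_suminf_not_top) auto
    then show False using False summable_on_atLeast1_iff[of f] nonneg by blast
  qed
  then show ?thesis using False by (simp add: infsum_not_exists)
qed

lemma l2norm_nonneg: "0 \<le> l2norm g"
  by (simp add: l2norm_def infsum_nonneg)

lemma l2norm_square: "(l2norm g)\<^sup>2 = (\<Sum>\<^sub>\<infinity>j\<in>{1..}. (g j)\<^sup>2)"
  by (simp add: l2norm_def infsum_nonneg)

lemma l2inner_self: "l2inner g g = (l2norm g)\<^sup>2"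
  unfolding l2inner_def l2norm_square by (simp add: power2_eq_square)

lemma ell2_mono:
  assumes "ell2 g" "\<And>j. 1 \<le> j \<Longrightarrow> \<bar>h j\<bar> \<le> \<bar>g j\<bar>"
  shows "ell2 h"
  using assms unfolding ell2_def
  by (auto intro!: summable_on_comparison_test[where f = "\<lambda>j. (g j)\<^sup>2"] simp: abs_le_square_iff)

lemma l2norm_mono:
  assumes "ell2 g" "\<And>j. 1 \<le> j \<Longrightarrow> \<bar>h j\<bar> \<le> \<bar>g j\<bar>"
  shows "l2norm h \<le> l2norm g"
  using assms ell2_mono[OF assms] unfolding l2norm_def ell2_def
  by (auto intro!: infsum_mono simp: abs_le_square_iff)

lemma L2_set_le_l2norm:
  assumes "ell2 g" "finite F" "F \<subseteq> {1..}"
  shows "L2_set g F \<le> l2norm g"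
  using assms unfolding L2_set_def l2norm_def ell2_def
  by (intro real_sqrt_le_mono finite_sum_le_infsum) auto

lemma ell2_l2norm_leI:
  assumes "\<And>F. finite F \<Longrightarrow> F \<subseteq> {1..} \<Longrightarrow> L2_set g F \<le> C"
  shows "ell2 g" "l2norm g \<le> C"
proof -
  have "0 \<le> C" using assms[of "{}"] by simp
  have bound: "(\<Sum>j\<in>F. (g j)\<^sup>2) \<le> C\<^sup>2" if "finite F" "F \<subseteq> {1..}" for F
    using assms[OF that] unfolding L2_set_def by (rule sqrt_le_D)
  then show "ell2 g"
    unfolding ell2_def by (intro nonneg_bdd_above_summable_on bdd_aboveI2[where M = "C\<^sup>2"]) auto
  then have "(l2norm g)\<^sup>2 \<le> C\<^sup>2"
    unfolding l2norm_square ell2_def using bound by (rule infsum_le_finite_sums)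
  then show "l2norm g \<le> C" using \<open>0 \<le> C\<close> by (rule power2_le_imp_le)
qed

lemma L2_set_add_le_l2norm:
  assumes "ell2 g" "ell2 h" "finite F" "F \<subseteq> {1..}"
  shows "L2_set (\<lambda>j. g j + h j) F \<le> l2norm g + l2norm h"
  using L2_set_triangle_ineq[of g h F] L2_set_le_l2norm[of g F] L2_set_le_l2norm[of h F] assms
  by linarith

lemma
  assumes "ell2 g" "ell2 h"
  shows ell2_add: "ell2 (\<lambda>j. g j + h j)"
    and l2norm_triangle_ineq: "l2norm (\<lambda>j. g j + h j) \<le> l2norm g + l2norm h"
  using ell2_l2norm_leI L2_set_add_le_l2norm[OF assms] by blast+

lemma ell2_diff: "ell2 g \<Longrightarrow> ell2 h \<Longrightarrow> ell2 (\<lambda>j. g j - h j)"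
  using ell2_add[of g "\<lambda>j. - h j"] by (simp add: ell2_def)

lemma sum_abs_product_le_l2norm:
  assumes "ell2 g" "ell2 h" "finite F" "F \<subseteq> {1..}"
  shows "(\<Sum>j\<in>F. \<bar>g j * h j\<bar>) \<le> l2norm g * l2norm h"
proof -
  have "(\<Sum>j\<in>F. \<bar>g j * h j\<bar>) \<le> L2_set g F * L2_set h F"
    using L2_set_mult_ineq by (simp add: abs_mult)
  also have "\<dots> \<le> l2norm g * l2norm h"
    using assms by (intro mult_mono L2_set_le_l2norm l2norm_nonneg L2_set_nonneg)
  finally show ?thesis .
qed

lemma ell2_product_summable:
  assumes "ell2 g" "ell2 h"
  shows "(\<lambda>j. g j * h j) summable_on {1..}"
proof -
  have "(\<lambda>j. \<bar>g j * h j\<bar>) summable_on {1..}"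
    using sum_abs_product_le_l2norm[OF assms]
    by (intro nonneg_bdd_above_summable_on bdd_aboveI2[where M = "l2norm g * l2norm h"]) auto
  then show ?thesis using abs_summable_summable[of "\<lambda>j. g j * h j"] by simp
qed

lemma l2inner_Cauchy_Schwarz:
  assumes "ell2 g" "ell2 h"
  shows "l2inner g h \<le> l2norm g * l2norm h"
  unfolding l2inner_def
proof (rule infsum_le_finite_sums[OF ell2_product_summable[OF assms]])
  show "(\<Sum>j\<in>F. g j * h j) \<le> l2norm g * l2norm h" if "finite F" "F \<subseteq> {1..}" for F
    by (rule order_trans[OF sum_mono sum_abs_product_le_l2norm[OF assms that]]) simp
qed

lemma l2inner_diff_right:
  assumes "ell2 g" "ell2 h" "ell2 k"
  shows "l2inner g (\<lambda>j. h j - k j) = l2inner g h - l2inner g k"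
proof -
  have "l2inner g (\<lambda>j. h j - k j) = (\<Sum>\<^sub>\<infinity>j\<in>{1..}. g j * h j + - (g j * k j))"
    unfolding l2inner_def by (simp add: algebra_simps)
  also have "\<dots> = l2inner g h + (\<Sum>\<^sub>\<infinity>j\<in>{1..}. - (g j * k j))"
    unfolding l2inner_def
    by (intro infsum_add summable_on_uminus[THEN iffD2] ell2_product_summable assms)
  finally show ?thesis by (simp add: infsum_uminus l2inner_def)
qed

definition head :: "nat \<Rightarrow> (nat \<Rightarrow> real) \<Rightarrow> nat \<Rightarrow> real" where
  "head m g j = (if j \<le> m then g j else 0)"

definition tail :: "nat \<Rightarrow> (nat \<Rightarrow> real) \<Rightarrow> nat \<Rightarrow> real" where
  "tail m g j = (if j \<le> m then 0 else g j)"

lemma diff_head: "(\<lambda>j. g j - head m g j) = tail m g"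
  by (auto simp: head_def tail_def)

lemma ell2_head: "ell2 g \<Longrightarrow> ell2 (head m g)"
  by (rule ell2_mono) (auto simp: head_def)

lemma ell2_tail: "ell2 g \<Longrightarrow> ell2 (tail m g)"
  by (rule ell2_mono) (auto simp: tail_def)

lemma l2norm_head_le: "ell2 g \<Longrightarrow> l2norm (head m g) \<le> l2norm g"
  by (rule l2norm_mono) (auto simp: head_def)

lemma l2norm_tail_le: "ell2 g \<Longrightarrow> l2norm (tail m g) \<le> l2norm g"
  by (rule l2norm_mono) (auto simp: tail_def)

lemma l2norm_tail_antimono: "ell2 g \<Longrightarrow> k \<le> m \<Longrightarrow> l2norm (tail m g) \<le> l2norm (tail k g)"
  by (rule l2norm_mono) (auto simp: tail_def intro: ell2_tail)

lemma l2norm_head_tail: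
  assumes "ell2 g"
  shows "(l2norm g)\<^sup>2 = (l2norm (head m g))\<^sup>2 + (l2norm (tail m g))\<^sup>2"
proof -
  have split: "(g j)\<^sup>2 = (head m g j)\<^sup>2 + (tail m g j)\<^sup>2" for j by (simp add: head_def tail_def)
  show ?thesis unfolding l2norm_square split
    using ell2_head[OF assms] ell2_tail[OF assms] by (intro infsum_add) (auto simp: ell2_def)
qed

lemma l2inner_head_tail:
  assumes "ell2 g" "ell2 h"
  shows "l2inner g h = l2inner (head m g) h + l2inner g (tail m h)"
proof -
  have split: "g j * h j = head m g j * h j + g j * tail m h j" for j
    by (simp add: head_def tail_def)
  have "l2inner g h = (\<Sum>\<^sub>\<infinity>j\<in>{1..}. head m g j * h j + g j * tail m h j)"
    unfolding l2inner_def by (simp only: split)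
  also have "\<dots> = l2inner (head m g) h + l2inner g (tail m h)"
    unfolding l2inner_def
    by (rule infsum_add) (intro ell2_product_summable ell2_head ell2_tail assms)+
  finally show ?thesis .
qed

lemma l2norm_head_square: "(l2norm (head m g))\<^sup>2 = (\<Sum>j\<in>{1..m}. (g j)\<^sup>2)"
proof -
  have "(l2norm (head m g))\<^sup>2 = (\<Sum>\<^sub>\<infinity>j\<in>{1..m}. (g j)\<^sup>2)"
    unfolding l2norm_square by (rule infsum_cong_neutral) (auto simp: head_def)
  then show ?thesis by simp
qed

lemma l2norm_tail_tendsto_0:
  assumes "ell2 g"
  shows "(\<lambda>m. l2norm (tail m g)) \<longlonglongrightarrow> 0"
proof -
  have head: "(\<Sum>j<Suc m. of_bool (1 \<le> j) * (g j)\<^sup>2) = (l2norm (head m g))\<^sup>2" for m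
    unfolding l2norm_head_square by (rule sum.mono_neutral_cong_right) auto
  have "(\<lambda>j. of_bool (1 \<le> j) * (g j)\<^sup>2) sums (l2norm g)\<^sup>2"
    unfolding l2norm_square using assms by (intro sums_infsum_atLeast1) (simp add: ell2_def)
  then have "(\<lambda>m. \<Sum>j<Suc m. of_bool (1 \<le> j) * (g j)\<^sup>2) \<longlonglongrightarrow> (l2norm g)\<^sup>2"
    unfolding sums_def by (rule LIMSEQ_Suc)
  then have "(\<lambda>m. (l2norm (head m g))\<^sup>2) \<longlonglongrightarrow> (l2norm g)\<^sup>2"
    unfolding head .
  then have "(\<lambda>m. sqrt ((l2norm g)\<^sup>2 - (l2norm (head m g))\<^sup>2)) \<longlonglongrightarrow> sqrt ((l2norm g)\<^sup>2 - (l2norm g)\<^sup>2)"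
    by (rule tendsto_real_sqrt[OF tendsto_diff[OF tendsto_const]])
  moreover have "sqrt ((l2norm g)\<^sup>2 - (l2norm (head m g))\<^sup>2) = l2norm (tail m g)" for m
    using l2norm_head_tail[OF assms, of m] by (simp add: l2norm_nonneg)
  ultimately show ?thesis by simp
qed

lemma l2norm_square_le_head_if_orthogonal:
  assumes ell2_g: "ell2 g" and ell2_f: "ell2 f" and orth: "l2inner g (\<lambda>j. f j - g j) = 0"
    and tail: "2 * l2norm (tail m f) \<le> l2norm g"
  shows "(l2norm g)\<^sup>2 \<le> 2 * (l2norm (head m g) * l2norm f)"
proof -
  have "(l2norm g)\<^sup>2 = l2inner g f"
    using l2inner_diff_right[OF ell2_g ell2_f ell2_g] orth by (simp add: l2inner_self)
  also have "\<dots> = l2inner (head m g) f + l2inner g (tail m f)"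
    by (rule l2inner_head_tail[OF ell2_g ell2_f])
  also have "\<dots> \<le> l2norm (head m g) * l2norm f + l2norm g * l2norm (tail m f)"
    by (intro add_mono l2inner_Cauchy_Schwarz ell2_head ell2_tail ell2_g ell2_f)
  also have "l2norm g * l2norm (tail m f) \<le> (l2norm g)\<^sup>2 / 2"
    using mult_left_mono[OF tail l2norm_nonneg[of g]] by (simp add: power2_eq_square)
  finally show ?thesis by simp
qed

lemma besov_mono: "P \<le> P' \<Longrightarrow> besov s P \<subseteq> besov s P'"
  unfolding besov_def using order_trans by blast

lemma besov_tail_le:
  assumes "g \<in> besov s P" "0 < m"
  shows "real m powr (2 * s) * (l2norm (tail m g))\<^sup>2 \<le> P"
proof -
  have tail: "(l2norm (tail m g))\<^sup>2 = (\<Sum>\<^sub>\<infinity>j\<in>{j. 1 \<le> j \<and> real j > real m}. (g j)\<^sup>2)"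
    unfolding l2norm_square by (rule infsum_cong_neutral) (auto simp: tail_def)
  have "0 < real m" using assms(2) by simp
  then show ?thesis using assms(1) unfolding besov_def tail by blast
qed

lemma head_in_besov:
  assumes "0 \<le> s" and ell2_g: "ell2 g"
  shows "head m g \<in> besov s (real m powr (2 * s) * (l2norm g)\<^sup>2)"
  unfolding besov_def
proof (intro CollectI allI impI)
  fix L :: real
  assume "0 < L"
  let ?J = "{j::nat. 1 \<le> j \<and> real j > L}"
  show "L powr (2 * s) * (\<Sum>\<^sub>\<infinity>j\<in>?J. (head m g j)\<^sup>2) \<le> real m powr (2 * s) * (l2norm g)\<^sup>2"
  proof (cases "real m \<le> L")
    case True
    have "(\<Sum>\<^sub>\<infinity>j\<in>?J. (head m g j)\<^sup>2) = 0"
      by (rule infsum_0) (use True in \<open>auto simp: head_def\<close>)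
    then show ?thesis by simp
  next
    case False
    have summable: "(\<lambda>j. (head m g j)\<^sup>2) summable_on {1..}"
      using ell2_head[OF ell2_g] by (simp add: ell2_def)
    have "(\<Sum>\<^sub>\<infinity>j\<in>?J. (head m g j)\<^sup>2) \<le> (l2norm (head m g))\<^sup>2"
      unfolding l2norm_square
      by (rule infsum_mono_neutral[OF summable_on_subset_banach[OF summable] summable]) auto
    also have "\<dots> \<le> (l2norm g)\<^sup>2" by (intro power_mono l2norm_head_le l2norm_nonneg ell2_g)
    finally show ?thesis
      using \<open>0 < L\<close> \<open>0 \<le> s\<close> False by (intro mult_mono powr_mono2 infsum_nonneg) auto
  qed
qed

section \<open>Nonincreasing weights\<close>

definition energy :: "(nat \<Rightarrow> real) \<Rightarrow> (nat \<Rightarrow> real) \<Rightarrow> real" where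
  "energy a g = (\<Sum>\<^sub>\<infinity>j\<in>{1..}. a j * (g j)\<^sup>2)"

definition median_index :: "(nat \<Rightarrow> real) \<Rightarrow> nat" where
  "median_index a = Sup {k. (\<Sum>j\<in>{1..<k}. a j) \<le> infsum a {1..} / 2}"

locale nonincreasing_weights =
  fixes a :: "nat \<Rightarrow> real"
  assumes nonneg: "\<And>j. 0 \<le> a j" and antimono: "\<And>i j. 1 \<le> i \<Longrightarrow> i \<le> j \<Longrightarrow> a j \<le> a i"
begin

lemma energy_nonneg: "0 \<le> energy a g"
  unfolding energy_def using nonneg by (intro infsum_nonneg) simp

lemma energy_summable:
  assumes "ell2 g"
  shows "(\<lambda>j. a j * (g j)\<^sup>2) summable_on {1..}"
proof (rule summable_on_comparison_test)
  show "(\<lambda>j. a 1 * (g j)\<^sup>2) summable_on {1..}"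
    using assms by (intro summable_on_cmult_right) (simp add: ell2_def)
qed (use antimono nonneg in \<open>auto intro!: mult_right_mono\<close>)

lemma energy_le:
  assumes ell2_g: "ell2 g" and "1 \<le> m" and vanish: "\<And>j. 1 \<le> j \<Longrightarrow> j < m \<Longrightarrow> g j = 0"
  shows "energy a g \<le> a m * (l2norm g)\<^sup>2"
proof -
  have summable: "(\<lambda>j. (g j)\<^sup>2) summable_on {1..}" using ell2_g by (simp add: ell2_def)
  have "a j * (g j)\<^sup>2 \<le> a m * (g j)\<^sup>2" if "1 \<le> j" for j
    using antimono[OF \<open>1 \<le> m\<close>, of j] vanish[OF that]
    by (cases "j < m") (auto intro: mult_right_mono)
  then have "energy a g \<le> (\<Sum>\<^sub>\<infinity>j\<in>{1..}. a m * (g j)\<^sup>2)"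
    unfolding energy_def
    by (intro infsum_mono energy_summable ell2_g summable_on_cmult_right summable) auto
  then show ?thesis
    unfolding l2norm_square using summable by (simp add: infsum_cmult_right)
qed

lemma energy_ge_head:
  assumes "ell2 g"
  shows "a m * (l2norm (head m g))\<^sup>2 \<le> energy a g"
proof -
  have "a m * (l2norm (head m g))\<^sup>2 = (\<Sum>j\<in>{1..m}. a m * (g j)\<^sup>2)"
    by (simp add: l2norm_head_square sum_distrib_left)
  also have "\<dots> \<le> (\<Sum>j\<in>{1..m}. a j * (g j)\<^sup>2)"
    using antimono by (intro sum_mono mult_right_mono) auto
  also have "\<dots> \<le> energy a g"
    unfolding energy_def
    by (rule finite_sum_le_infsum[OF energy_summable[OF assms]]) (use nonneg in auto)
  finally show ?thesis .
qed

lemma l2norm_square_le_mult_infsum: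
  assumes summable: "a summable_on {1..}"
  shows "(l2norm a)\<^sup>2 \<le> a 1 * infsum a {1..}"
proof -
  have square_le: "(a j)\<^sup>2 \<le> a 1 * a j" if "1 \<le> j" for j
    using mult_right_mono[OF antimono[of 1 j] nonneg] that by (simp add: power2_eq_square)
  have majorant: "(\<lambda>j. a 1 * a j) summable_on {1..}"
    by (intro summable_on_cmult_right summable)
  have "(l2norm a)\<^sup>2 \<le> (\<Sum>\<^sub>\<infinity>j\<in>{1..}. a 1 * a j)"
    unfolding l2norm_square
    using square_le by (intro infsum_mono summable_on_comparison_test[OF majorant] majorant) auto
  then show ?thesis using summable by (simp add: infsum_cmult_right)
qed

lemma mult_square_le_l2norm_square:
  assumes "ell2 a"
  shows "real k * (a k)\<^sup>2 \<le> (l2norm a)\<^sup>2"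
proof -
  have "real k * (a k)\<^sup>2 = (\<Sum>j\<in>{1..k}. (a k)\<^sup>2)" by simp
  also have "\<dots> \<le> (\<Sum>j\<in>{1..k}. (a j)\<^sup>2)" by (intro sum_mono power_mono antimono nonneg) auto
  also have "\<dots> \<le> (l2norm a)\<^sup>2"
    using assms unfolding l2norm_square ell2_def by (intro finite_sum_le_infsum) auto
  finally show ?thesis .
qed

lemma finite_median_candidates:
  assumes summable: "a summable_on {1..}" and pos: "0 < infsum a {1..}"
  shows "finite {k. (\<Sum>j\<in>{1..<k}. a j) \<le> infsum a {1..} / 2}"
proof -
  have "(\<lambda>m. \<Sum>j<m. of_bool (1 \<le> j) * a j) \<longlonglongrightarrow> infsum a {1..}"
    using sums_infsum_atLeast1[OF summable] by (simp add: sums_def)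
  then have "\<forall>\<^sub>F m in sequentially. infsum a {1..} / 2 < (\<Sum>j<m. of_bool (1 \<le> j) * a j)"
    using pos by (intro order_tendstoD) auto
  moreover have "(\<Sum>j<m. of_bool (1 \<le> j) * a j) = (\<Sum>j\<in>{1..<m}. a j)" for m
    by (rule sum.mono_neutral_cong_right) auto
  ultimately have "\<forall>\<^sub>F m in sequentially. \<not> (\<Sum>j\<in>{1..<m}. a j) \<le> infsum a {1..} / 2"
    by (simp add: not_le)
  then show ?thesis unfolding cofinite_eq_sequentially[symmetric] eventually_cofinite by simp
qed

lemma median_index_ge_1:
  assumes "a summable_on {1..}" "0 < infsum a {1..}"
  shows "1 \<le> median_index a"
  using finite_median_candidates[OF assms] assms(2)
  unfolding median_index_def by (intro cSup_upper bdd_above_finite) auto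

lemma half_infsum_le_median_index:
  assumes "a summable_on {1..}" "0 < infsum a {1..}"
  shows "infsum a {1..} / 2 \<le> real (median_index a) * a 1"
proof -
  let ?k = "median_index a"
  have "\<not> (\<Sum>j\<in>{1..<Suc ?k}. a j) \<le> infsum a {1..} / 2"
  proof
    assume "(\<Sum>j\<in>{1..<Suc ?k}. a j) \<le> infsum a {1..} / 2"
    then have "Suc ?k \<le> ?k"
      using finite_median_candidates[OF assms]
      unfolding median_index_def by (intro cSup_upper bdd_above_finite) auto
    then show False by simp
  qed
  then have "infsum a {1..} / 2 \<le> (\<Sum>j\<in>{1..<Suc ?k}. a j)" by simp
  also have "\<dots> \<le> (\<Sum>j\<in>{1..<Suc ?k}. a 1)" by (intro sum_mono antimono) auto
  finally show ?thesis by simp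
qed

end

section \<open>Domination up to constants\<close>

text \<open>Vinogradov's symbol, with a bound that holds for every sample size and not just eventually.\<close>

definition lless :: "(nat \<Rightarrow> real) \<Rightarrow> (nat \<Rightarrow> real) \<Rightarrow> bool" (infix "\<lless>" 50) where
  "f \<lless> g \<longleftrightarrow> (\<exists>C>0. \<forall>n\<ge>1. f n \<le> C * g n)"

lemma llessE:
  assumes "f \<lless> g"
  obtains C where "0 < C" "\<And>n. 1 \<le> n \<Longrightarrow> f n \<le> C * g n"
  using assms unfolding lless_def by blast

lemma llessI: "0 < C \<Longrightarrow> (\<And>n. 1 \<le> n \<Longrightarrow> f n \<le> C * g n) \<Longrightarrow> f \<lless> g"
  unfolding lless_def by blast

lemma llessI_nonneg:
  assumes "\<And>n. 1 \<le> n \<Longrightarrow> f n \<le> C * g n" "\<And>n. 1 \<le> n \<Longrightarrow> 0 \<le> g n"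
  shows "f \<lless> g"
proof (rule llessI[of "max C 1"])
  show "f n \<le> max C 1 * g n" if "1 \<le> n" for n
    by (rule order_trans[OF assms(1)[OF that] mult_right_mono[OF max.cobounded1 assms(2)[OF that]]])
qed simp

lemma lless_refl: "f \<lless> f"
  by (rule llessI[of 1]) auto

lemma lless_powr_imp_pos:
  assumes "(\<lambda>n. real n powr p) \<lless> f" "1 \<le> n"
  shows "0 < f n"
proof -
  obtain C where "0 < C" "real n powr p \<le> C * f n" using llessE[OF assms(1)] assms(2) by blast
  moreover have "0 < real n powr p" using assms(2) by simp
  ultimately have "0 < C * f n" by linarith
  then show ?thesis using \<open>0 < C\<close> by (rule zero_less_mult_pos)
qed

lemma le_imp_lless: "(\<And>n. 1 \<le> n \<Longrightarrow> f n \<le> g n) \<Longrightarrow> f \<lless> g"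
  by (rule llessI[of 1]) auto

lemma lless_trans [trans]:
  assumes "f \<lless> g" "g \<lless> h"
  shows "f \<lless> h"
proof -
  obtain C where bound_C: "0 < C" "\<And>n. 1 \<le> n \<Longrightarrow> f n \<le> C * g n" using llessE[OF assms(1)] by blast
  obtain D where bound_D: "0 < D" "\<And>n. 1 \<le> n \<Longrightarrow> g n \<le> D * h n" using llessE[OF assms(2)] by blast
  show ?thesis
  proof (rule llessI[of "C * D"])
    show "f n \<le> C * D * h n" if "1 \<le> n" for n
      using order_trans[OF bound_C(2)[OF that] mult_left_mono[OF bound_D(2)[OF that], of C]]
        bound_C(1)
      by (simp add: mult.assoc)
  qed (use bound_C(1) bound_D(1) in simp)
qed

lemma lless_mult:
  assumes "f1 \<lless> g1" "f2 \<lless> g2"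
    and nonneg: "\<And>n. 1 \<le> n \<Longrightarrow> 0 \<le> f1 n" "\<And>n. 1 \<le> n \<Longrightarrow> 0 \<le> f2 n"
  shows "(\<lambda>n. f1 n * f2 n) \<lless> (\<lambda>n. g1 n * g2 n)"
proof -
  obtain C where bound_C: "0 < C" "\<And>n. 1 \<le> n \<Longrightarrow> f1 n \<le> C * g1 n" using llessE[OF assms(1)] by blast
  obtain D where bound_D: "0 < D" "\<And>n. 1 \<le> n \<Longrightarrow> f2 n \<le> D * g2 n" using llessE[OF assms(2)] by blast
  show ?thesis
  proof (rule llessI[of "C * D"])
    show "f1 n * f2 n \<le> C * D * (g1 n * g2 n)" if "1 \<le> n" for n
    proof -
      have "f1 n * f2 n \<le> (C * g1 n) * (D * g2 n)"
        using bound_C(2)[OF that] bound_D(2)[OF that] nonneg[OF that] by (intro mult_mono) auto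
      then show ?thesis by (simp add: mult_ac)
    qed
  qed (use bound_C(1) bound_D(1) in simp)
qed

lemma lless_inverse:
  assumes "f \<lless> g" and pos: "\<And>n. 1 \<le> n \<Longrightarrow> 0 < f n"
  shows "(\<lambda>n. inverse (g n)) \<lless> (\<lambda>n. inverse (f n))"
proof -
  obtain C where bound: "0 < C" "\<And>n. 1 \<le> n \<Longrightarrow> f n \<le> C * g n" using llessE[OF assms(1)] by blast
  show ?thesis
  proof (rule llessI[OF bound(1)])
    fix n :: nat
    assume n_ge_1: "1 \<le> n"
    have "inverse (g n) = C * inverse (C * g n)" using bound(1) by simp
    also have "\<dots> \<le> C * inverse (f n)"
      using bound(1)
      by (intro mult_left_mono le_imp_inverse_le[OF bound(2)[OF n_ge_1] pos[OF n_ge_1]]) simp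
    finally show "inverse (g n) \<le> C * inverse (f n)" .
  qed
qed

lemma lless_divide:
  assumes "f1 \<lless> g1" "g2 \<lless> f2"
    and "\<And>n. 1 \<le> n \<Longrightarrow> 0 \<le> f1 n" and pos: "\<And>n. 1 \<le> n \<Longrightarrow> 0 < g2 n"
  shows "(\<lambda>n. f1 n / f2 n) \<lless> (\<lambda>n. g1 n / g2 n)"
proof -
  obtain C where bound: "0 < C" "\<And>n. 1 \<le> n \<Longrightarrow> g2 n \<le> C * f2 n" using llessE[OF assms(2)] by blast
  have "0 < f2 n" if "1 \<le> n" for n
    using less_le_trans[OF pos[OF that] bound(2)[OF that]] bound(1) by (rule zero_less_mult_pos)
  then have "0 \<le> inverse (f2 n)" if "1 \<le> n" for n using that by (simp add: less_imp_le)
  then show ?thesis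
    unfolding divide_inverse by (intro lless_mult lless_inverse assms)
qed

lemma lless_mult_imp_divide_lless:
  assumes "f \<lless> (\<lambda>n. g n * h n)" and "\<And>n. 1 \<le> n \<Longrightarrow> 0 < h n"
  shows "(\<lambda>n. f n / h n) \<lless> g"
  using assms unfolding lless_def by (simp add: pos_divide_le_eq mult.assoc)

lemma mult_lless_imp_lless_divide:
  assumes "(\<lambda>n. f n * h n) \<lless> g" and "\<And>n. 1 \<le> n \<Longrightarrow> 0 < h n"
  shows "f \<lless> (\<lambda>n. g n / h n)"
  using assms unfolding lless_def by (simp add: pos_le_divide_eq)

lemma lless_powr:
  assumes "f \<lless> g" and nonneg: "\<And>n. 1 \<le> n \<Longrightarrow> 0 \<le> f n" and "0 \<le> p"
  shows "(\<lambda>n. f n powr p) \<lless> (\<lambda>n. g n powr p)"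
proof -
  obtain C where bound: "0 < C" "\<And>n. 1 \<le> n \<Longrightarrow> f n \<le> C * g n" using llessE[OF assms(1)] by blast
  show ?thesis
  proof (rule llessI[of "C powr p"])
    show "f n powr p \<le> C powr p * g n powr p" if "1 \<le> n" for n
      using powr_mono2[OF \<open>0 \<le> p\<close> nonneg bound(2), of n] that bound(1) by (simp add: powr_mult)
  qed (use bound(1) in simp)
qed

lemma tendsto_0_if_lless:
  assumes "f \<lless> g" and nonneg: "\<And>n. 1 \<le> n \<Longrightarrow> 0 \<le> f n" and "g \<longlonglongrightarrow> 0"
  shows "f \<longlonglongrightarrow> 0"
proof -
  obtain C where bound: "\<And>n. 1 \<le> n \<Longrightarrow> f n \<le> C * g n" using llessE[OF assms(1)] by blast
  have "\<forall>\<^sub>F n in sequentially. norm (f n) \<le> C * g n"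
    using eventually_ge_at_top[of 1] by eventually_elim (use bound nonneg in simp)
  then show ?thesis
    by (rule Lim_null_comparison) (rule tendsto_mult_right_zero[OF \<open>g \<longlonglongrightarrow> 0\<close>])
qed

section \<open>Orders of magnitude of the weights\<close>

lemma kn_eq_median_index: "kn \<kappa> n = median_index (\<kappa> n)"
  by (simp add: kn_def median_index_def rho_def)

locale quadratic_test = gaussian_noise M \<xi> for M :: "'a measure" and \<xi> +
  fixes \<sigma> r :: real and \<kappa> :: "nat \<Rightarrow> nat \<Rightarrow> real"
  assumes sigma: "\<sigma> > 0"
    and r: "0 < r" "r < 1/2"
    and kappa_nonneg: "\<forall>n j. 0 \<le> \<kappa> n j"
    and kappa_summable: "\<forall>n\<ge>1. \<kappa> n summable_on {1..}"
    and kappa_Suc_le: "\<forall>n\<ge>1. \<forall>j\<ge>1. \<kappa> n (Suc j) \<le> \<kappa> n j"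
    and kappa_square_bounds: "\<exists>C1 C2. 0 < C1 \<and> (\<forall>n\<ge>1.
               C1 < \<sigma> powr (-4) * (real n)^2 * (\<Sum>\<^sub>\<infinity>j\<in>{1..}. (\<kappa> n j)^2)
             \<and> \<sigma> powr (-4) * (real n)^2 * (\<Sum>\<^sub>\<infinity>j\<in>{1..}. (\<kappa> n j)^2) < C2)"
    and rho_bounds: "\<exists>c1 c2. 0 < c1 \<and> (\<forall>n\<ge>1. c1 * real n powr (-2*r) \<le> rho \<kappa> n
                                  \<and> rho \<kappa> n \<le> c2 * real n powr (-2*r))"
    and kappa_decay: "\<exists>C1 lam. C1 > 0 \<and> lam > 1 \<and> (\<forall>\<delta>>0. \<forall>n\<ge>1.
               \<kappa> n (nat \<lfloor>(1 + \<delta>) * real (kn \<kappa> n)\<rfloor>) < C1 * (1 + \<delta>) powr (-lam) * kappa_n \<kappa> n)"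
    and kappa_1_bounds: "\<exists>c C. 0 < c \<and> (\<forall>n\<ge>1. c * kappa_n \<kappa> n \<le> \<kappa> n 1 \<and> \<kappa> n 1 \<le> C * kappa_n \<kappa> n)"
    and kappa_multiple_kn_ge: "\<forall>c>1. \<exists>C>0. \<forall>n\<ge>1. \<kappa> n (nat \<lfloor>c * real (kn \<kappa> n)\<rfloor>) \<ge> C * kappa_n \<kappa> n"
begin

lemma nonincreasing_kappa:
  assumes "1 \<le> n"
  shows "nonincreasing_weights (\<kappa> n)"
proof
  show "\<kappa> n j \<le> \<kappa> n i" if "1 \<le> i" "i \<le> j" for i j
    using that(2)
  proof (induction rule: dec_induct)
    case (step m)
    then show ?case using kappa_Suc_le \<open>1 \<le> n\<close> \<open>1 \<le> i\<close> order_trans[of "\<kappa> n (Suc m)" "\<kappa> n m"] by simp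
  qed simp
qed (use kappa_nonneg in simp)

lemma rho_orders:
  "(\<lambda>n. real n powr (-2*r)) \<lless> rho \<kappa>" "rho \<kappa> \<lless> (\<lambda>n. real n powr (-2*r))"
proof -
  obtain c1 c2 where "0 < c1" and bounds: "\<And>n. 1 \<le> n \<Longrightarrow> c1 * real n powr (-2*r) \<le> rho \<kappa> n"
    "\<And>n. 1 \<le> n \<Longrightarrow> rho \<kappa> n \<le> c2 * real n powr (-2*r)"
    using rho_bounds by blast
  show "(\<lambda>n. real n powr (-2*r)) \<lless> rho \<kappa>"
    using \<open>0 < c1\<close> bounds(1) by (intro llessI[of "1 / c1"]) (auto simp: field_simps)
  show "rho \<kappa> \<lless> (\<lambda>n. real n powr (-2*r))"
    using bounds(2) by (intro llessI_nonneg) auto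
qed

lemma l2norm_kappa_square_orders:
  "(\<lambda>n. real n powr (-2)) \<lless> (\<lambda>n. (l2norm (\<kappa> n))\<^sup>2)"
  "(\<lambda>n. (l2norm (\<kappa> n))\<^sup>2) \<lless> (\<lambda>n. real n powr (-2))"
proof -
  obtain C1 C2 where "0 < C1"
    and bounds: "\<And>n. 1 \<le> n \<Longrightarrow> C1 < \<sigma> powr (-4) * (real n)\<^sup>2 * (l2norm (\<kappa> n))\<^sup>2"
    "\<And>n. 1 \<le> n \<Longrightarrow> \<sigma> powr (-4) * (real n)\<^sup>2 * (l2norm (\<kappa> n))\<^sup>2 < C2"
    using kappa_square_bounds unfolding l2norm_square by blast
  have sigma4: "0 < \<sigma> powr (-4)" using sigma by simp
  have powr_minus_2: "real n powr (-2) = 1 / (real n)\<^sup>2" for n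
    by (simp add: powr_minus_divide)
  show "(\<lambda>n. real n powr (-2)) \<lless> (\<lambda>n. (l2norm (\<kappa> n))\<^sup>2)"
  proof (rule llessI[of "\<sigma> powr (-4) / C1"])
    show "real n powr (-2) \<le> \<sigma> powr (-4) / C1 * (l2norm (\<kappa> n))\<^sup>2" if "1 \<le> n" for n
      unfolding powr_minus_2 using bounds(1)[OF that] \<open>0 < C1\<close> that by (simp add: field_simps)
  qed (use \<open>0 < C1\<close> sigma4 in simp)
  show "(\<lambda>n. (l2norm (\<kappa> n))\<^sup>2) \<lless> (\<lambda>n. real n powr (-2))"
  proof (rule llessI_nonneg)
    show "(l2norm (\<kappa> n))\<^sup>2 \<le> C2 / \<sigma> powr (-4) * real n powr (-2)" if "1 \<le> n" for n
      unfolding powr_minus_2 using bounds(2)[OF that] sigma4 that by (simp add: field_simps)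
  qed simp
qed

lemma l2norm_kappa_orders:
  "(\<lambda>n. real n powr (-1)) \<lless> (\<lambda>n. l2norm (\<kappa> n))" "(\<lambda>n. l2norm (\<kappa> n)) \<lless> (\<lambda>n. real n powr (-1))"
  using lless_powr[OF l2norm_kappa_square_orders(1), of "1 / 2"]
    lless_powr[OF l2norm_kappa_square_orders(2), of "1 / 2"]
  by (simp_all add: powr_powr powr_half_sqrt l2norm_nonneg)

lemma rho_pos: "1 \<le> n \<Longrightarrow> 0 < rho \<kappa> n"
  by (rule lless_powr_imp_pos[OF rho_orders(1)])

lemma l2norm_kappa_pos: "1 \<le> n \<Longrightarrow> 0 < l2norm (\<kappa> n)"
  by (rule lless_powr_imp_pos[OF l2norm_kappa_orders(1)])

lemma ell2_kappa: "1 \<le> n \<Longrightarrow> ell2 (\<kappa> n)"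
  using l2norm_kappa_pos[of n] infsum_not_exists[of "\<lambda>j. (\<kappa> n j)\<^sup>2" "{1..}"]
  by (auto simp: l2norm_def ell2_def)

lemma kn_ge_1: "1 \<le> n \<Longrightarrow> 1 \<le> kn \<kappa> n"
  unfolding kn_eq_median_index using kappa_summable rho_pos[of n]
  by (intro nonincreasing_weights.median_index_ge_1[OF nonincreasing_kappa]) (auto simp: rho_def)

lemma half_rho_le: "1 \<le> n \<Longrightarrow> rho \<kappa> n / 2 \<le> real (kn \<kappa> n) * \<kappa> n 1"
  unfolding kn_eq_median_index rho_def using kappa_summable rho_pos[of n]
  by (intro nonincreasing_weights.half_infsum_le_median_index[OF nonincreasing_kappa])
     (auto simp: rho_def)

lemma kappa_n_nonneg: "0 \<le> kappa_n \<kappa> n"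
  using kappa_nonneg by (simp add: kappa_n_def)

lemma kappa_1_lless: "(\<lambda>n. \<kappa> n 1) \<lless> kappa_n \<kappa>"
proof -
  obtain C where "\<And>n. 1 \<le> n \<Longrightarrow> \<kappa> n 1 \<le> C * kappa_n \<kappa> n" using kappa_1_bounds by blast
  then show ?thesis using kappa_n_nonneg by (rule llessI_nonneg)
qed

lemma kappa_n_pos:
  assumes "1 \<le> n"
  shows "0 < kappa_n \<kappa> n"
proof -
  have "0 < real (kn \<kappa> n) * \<kappa> n 1" using rho_pos[OF assms] half_rho_le[OF assms] by simp
  then have "0 < \<kappa> n 1" by (simp add: zero_less_mult_iff)
  moreover obtain C where "0 < C" "\<And>n. 1 \<le> n \<Longrightarrow> \<kappa> n 1 \<le> C * kappa_n \<kappa> n"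
    using llessE[OF kappa_1_lless] by blast
  ultimately have "0 < C * kappa_n \<kappa> n" using assms order.strict_trans2 by blast
  then show ?thesis using \<open>0 < C\<close> by (rule zero_less_mult_pos)
qed

lemma rho_lless_kn_mult_kappa_n: "rho \<kappa> \<lless> (\<lambda>n. real (kn \<kappa> n) * kappa_n \<kappa> n)"
proof -
  have "rho \<kappa> \<lless> (\<lambda>n. real (kn \<kappa> n) * \<kappa> n 1)"
  proof (rule llessI[of 2])
    show "rho \<kappa> n \<le> 2 * (real (kn \<kappa> n) * \<kappa> n 1)" if "1 \<le> n" for n
      using half_rho_le[OF that] by simp
  qed simp
  also have "\<dots> \<lless> (\<lambda>n. real (kn \<kappa> n) * kappa_n \<kappa> n)"
    using kappa_nonneg by (intro lless_mult lless_refl kappa_1_lless) auto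
  finally show ?thesis .
qed

lemma kn_mult_kappa_n_square_le:
  "1 \<le> n \<Longrightarrow> real (kn \<kappa> n) * (kappa_n \<kappa> n)\<^sup>2 \<le> (l2norm (\<kappa> n))\<^sup>2"
  unfolding kappa_n_def
  by (intro nonincreasing_weights.mult_square_le_l2norm_square nonincreasing_kappa ell2_kappa)

lemma l2norm_kappa_square_lless: "(\<lambda>n. (l2norm (\<kappa> n))\<^sup>2) \<lless> (\<lambda>n. kappa_n \<kappa> n * rho \<kappa> n)"
proof -
  have "(\<lambda>n. (l2norm (\<kappa> n))\<^sup>2) \<lless> (\<lambda>n. \<kappa> n 1 * rho \<kappa> n)"
    using nonincreasing_weights.l2norm_square_le_mult_infsum[OF nonincreasing_kappa] kappa_summable
    by (intro le_imp_lless) (auto simp: rho_def)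
  also have "\<dots> \<lless> (\<lambda>n. kappa_n \<kappa> n * rho \<kappa> n)"
    using kappa_nonneg rho_pos
    by (intro lless_mult lless_refl kappa_1_lless) (auto simp: less_imp_le)
  finally show ?thesis .
qed

lemma kappa_n_orders:
  "(\<lambda>n. real n powr (2*r - 2)) \<lless> kappa_n \<kappa>" "kappa_n \<kappa> \<lless> (\<lambda>n. real n powr (2*r - 2))"
proof -
  have rate: "real n powr (2*r - 2) = real n powr (-2) / real n powr (-2*r)" for n
    by (simp flip: powr_diff)
  have "(\<lambda>n. real n powr (-2) / real n powr (-2*r)) \<lless> (\<lambda>n. (l2norm (\<kappa> n))\<^sup>2 / rho \<kappa> n)"
    by (intro lless_divide l2norm_kappa_square_orders rho_orders) (auto intro: rho_pos)
  also have "\<dots> \<lless> kappa_n \<kappa>"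
    by (rule lless_mult_imp_divide_lless[OF l2norm_kappa_square_lless rho_pos])
  finally show "(\<lambda>n. real n powr (2*r - 2)) \<lless> kappa_n \<kappa>" unfolding rate .
  have "(\<lambda>n. kappa_n \<kappa> n * rho \<kappa> n) \<lless> (\<lambda>n. kappa_n \<kappa> n * (real (kn \<kappa> n) * kappa_n \<kappa> n))"
    by (intro lless_mult lless_refl rho_lless_kn_mult_kappa_n)
       (blast intro: less_imp_le kappa_n_nonneg rho_pos)+
  also have "\<dots> \<lless> (\<lambda>n. (l2norm (\<kappa> n))\<^sup>2)"
    using kn_mult_kappa_n_square_le by (intro le_imp_lless) (simp add: power2_eq_square mult_ac)
  finally have "kappa_n \<kappa> \<lless> (\<lambda>n. (l2norm (\<kappa> n))\<^sup>2 / rho \<kappa> n)"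
    using rho_pos by (rule mult_lless_imp_lless_divide)
  also have "\<dots> \<lless> (\<lambda>n. real n powr (-2) / real n powr (-2*r))"
    by (intro lless_divide l2norm_kappa_square_orders rho_orders) auto
  finally show "kappa_n \<kappa> \<lless> (\<lambda>n. real n powr (2*r - 2))" unfolding rate .
qed

lemma kn_orders:
  "(\<lambda>n. real n powr (2 - 4*r)) \<lless> (\<lambda>n. real (kn \<kappa> n))"
  "(\<lambda>n. real (kn \<kappa> n)) \<lless> (\<lambda>n. real n powr (2 - 4*r))"
proof -
  have "(\<lambda>n. real n powr (-2*r) / real n powr (2*r - 2)) \<lless> (\<lambda>n. rho \<kappa> n / kappa_n \<kappa> n)"
    by (intro lless_divide rho_orders kappa_n_orders) (auto intro: kappa_n_pos)
  also have "\<dots> \<lless> (\<lambda>n. real (kn \<kappa> n))"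
    by (rule lless_mult_imp_divide_lless[OF rho_lless_kn_mult_kappa_n kappa_n_pos])
  finally show "(\<lambda>n. real n powr (2 - 4*r)) \<lless> (\<lambda>n. real (kn \<kappa> n))"
    by (simp flip: powr_diff)
  have "(\<lambda>n. real (kn \<kappa> n) * (kappa_n \<kappa> n)\<^sup>2) \<lless> (\<lambda>n. (l2norm (\<kappa> n))\<^sup>2)"
    by (rule le_imp_lless[OF kn_mult_kappa_n_square_le])
  then have "(\<lambda>n. real (kn \<kappa> n)) \<lless> (\<lambda>n. (l2norm (\<kappa> n))\<^sup>2 / (kappa_n \<kappa> n)\<^sup>2)"
    by (rule mult_lless_imp_lless_divide) (intro zero_less_power kappa_n_pos)
  also have "\<dots> \<lless> (\<lambda>n. real n powr (-2) / (real n powr (2*r - 2) * real n powr (2*r - 2)))"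
    unfolding power2_eq_square[of "kappa_n \<kappa> _"]
    by (intro lless_divide lless_mult l2norm_kappa_square_orders kappa_n_orders) auto
  finally show "(\<lambda>n. real (kn \<kappa> n)) \<lless> (\<lambda>n. real n powr (2 - 4*r))"
    by (simp flip: powr_add powr_diff)
qed

lemma besov_exponent:
  "0 < r / (2 - 4*r)" "(2 - 4*r) * (2 * (r / (2 - 4*r))) = 2*r"
  using r by (auto simp: field_simps)

lemma kn_powr_orders:
  "(\<lambda>n. real n powr (2*r)) \<lless> (\<lambda>n. real (kn \<kappa> n) powr (2 * (r / (2 - 4*r))))"
  "(\<lambda>n. real (kn \<kappa> n) powr (2 * (r / (2 - 4*r)))) \<lless> (\<lambda>n. real n powr (2*r))"
  using lless_powr[OF kn_orders(1), of "2 * (r / (2 - 4*r))"]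
    lless_powr[OF kn_orders(2), of "2 * (r / (2 - 4*r))"] besov_exponent
  by (simp_all add: powr_powr)

section \<open>Error probabilities of the tests\<close>

text \<open>The standard deviation of \<open>T\<^sub>n\<close> under the hypothesis, since \<open>\<xi>\<^sub>j\<^sup>2\<close> has variance 2.\<close>

definition null_sd :: "nat \<Rightarrow> real" where
  "null_sd n = sqrt 2 * \<sigma>\<^sup>2 / real n * l2norm (\<kappa> n)"

definition snr :: "nat \<Rightarrow> (nat \<Rightarrow> real) \<Rightarrow> real" where
  "snr n g = energy (\<kappa> n) g / null_sd n"

text \<open>Index 0 carries no weight, so that sums over \<open>j \<ge> 1\<close> become series over all of \<open>nat\<close>.\<close>

definition weight :: "nat \<Rightarrow> nat \<Rightarrow> real" where
  "weight n j = of_bool (1 \<le> j) * \<kappa> n j / (sqrt 2 * l2norm (\<kappa> n))"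

definition std_signal :: "nat \<Rightarrow> (nat \<Rightarrow> real) \<Rightarrow> nat \<Rightarrow> real" where
  "std_signal n g j = sqrt (real n) / \<sigma> * g j"

lemma null_sd_pos: "1 \<le> n \<Longrightarrow> 0 < null_sd n"
  using l2norm_kappa_pos sigma by (simp add: null_sd_def)

lemma null_sd_orders:
  "(\<lambda>n. real n powr (-2)) \<lless> null_sd" "null_sd \<lless> (\<lambda>n. real n powr (-2))"
proof -
  have split: "real n powr (-2) = real n powr (-1) * real n powr (-1)" for n
    using powr_add[of "real n" "-1" "-1"] by simp
  have inv: "sqrt 2 * \<sigma>\<^sup>2 / real n = sqrt 2 * \<sigma>\<^sup>2 * real n powr (-1)" for n
    by (simp add: powr_minus_divide)
  have pos: "0 < sqrt 2 * \<sigma>\<^sup>2" using sigma by simp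
  have scale_ge: "(\<lambda>n. real n powr (-1)) \<lless> (\<lambda>n. sqrt 2 * \<sigma>\<^sup>2 / real n)"
    unfolding inv using pos by (intro llessI[of "1 / (sqrt 2 * \<sigma>\<^sup>2)"]) (auto simp: field_simps)
  have scale_le: "(\<lambda>n. sqrt 2 * \<sigma>\<^sup>2 / real n) \<lless> (\<lambda>n. real n powr (-1))"
    unfolding inv using pos by (intro llessI[of "sqrt 2 * \<sigma>\<^sup>2"]) auto
  show "(\<lambda>n. real n powr (-2)) \<lless> null_sd" "null_sd \<lless> (\<lambda>n. real n powr (-2))"
    unfolding split null_sd_def[abs_def]
    by (intro lless_mult scale_ge scale_le l2norm_kappa_orders; simp add: l2norm_nonneg)+
qed

lemma kappa_n_div_null_sd_orders:
  "(\<lambda>n. real n powr (2*r)) \<lless> (\<lambda>n. kappa_n \<kappa> n / null_sd n)"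
  "(\<lambda>n. kappa_n \<kappa> n / null_sd n) \<lless> (\<lambda>n. real n powr (2*r))"
proof -
  have rate: "real n powr (2*r) = real n powr (2*r - 2) / real n powr (-2)" for n
    by (simp flip: powr_diff)
  show "(\<lambda>n. real n powr (2*r)) \<lless> (\<lambda>n. kappa_n \<kappa> n / null_sd n)"
    "(\<lambda>n. kappa_n \<kappa> n / null_sd n) \<lless> (\<lambda>n. real n powr (2*r))"
    unfolding rate
    by (intro lless_divide kappa_n_orders null_sd_orders; auto intro: null_sd_pos kappa_n_nonneg)+
qed

lemma max_weight_tendsto_0: "(\<lambda>n. \<kappa> n 1 / (sqrt 2 * l2norm (\<kappa> n))) \<longlonglongrightarrow> 0"
proof (rule tendsto_0_if_lless)
  have rate: "real n powr (2*r - 1) = real n powr (2*r - 2) / real n powr (-1)" for n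
    using powr_diff[of "real n" "2*r - 2" "-1"] by simp
  have "(\<lambda>n. \<kappa> n 1) \<lless> (\<lambda>n. real n powr (2*r - 2))"
    using kappa_1_lless kappa_n_orders(2) by (rule lless_trans)
  moreover have "(\<lambda>n. real n powr (-1)) \<lless> (\<lambda>n. sqrt 2 * l2norm (\<kappa> n))"
    using l2norm_kappa_orders(1)
    by (rule lless_trans)
       (intro le_imp_lless, simp add: mult_le_cancel_right1 l2norm_nonneg not_less)
  ultimately show "(\<lambda>n. \<kappa> n 1 / (sqrt 2 * l2norm (\<kappa> n))) \<lless> (\<lambda>n. real n powr (2*r - 1))"
    unfolding rate using kappa_nonneg by (intro lless_divide) auto
  show "0 \<le> \<kappa> n 1 / (sqrt 2 * l2norm (\<kappa> n))" for n
    using kappa_nonneg by (simp add: l2norm_nonneg)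
  show "(\<lambda>n. real n powr (2*r - 1)) \<longlonglongrightarrow> 0"
    using r by (intro tendsto_neg_powr filterlim_real_sequentially) simp
qed

lemma weight_sums:
  assumes "1 \<le> n"
  shows "weight n sums (rho \<kappa> n / (sqrt 2 * l2norm (\<kappa> n)))"
    and "(\<lambda>j. (weight n j)\<^sup>2) sums (1 / 2)"
proof -
  show "weight n sums (rho \<kappa> n / (sqrt 2 * l2norm (\<kappa> n)))"
    unfolding weight_def[abs_def] rho_def using kappa_summable assms
    by (intro sums_divide sums_infsum_atLeast1) simp
  have "(\<lambda>j. of_bool (1 \<le> j) * (\<kappa> n j)\<^sup>2 / (2 * (l2norm (\<kappa> n))\<^sup>2))
      sums ((l2norm (\<kappa> n))\<^sup>2 / (2 * (l2norm (\<kappa> n))\<^sup>2))"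
    unfolding l2norm_square using ell2_kappa[OF assms]
    by (intro sums_divide sums_infsum_atLeast1) (simp add: ell2_def)
  moreover have "(weight n j)\<^sup>2 = of_bool (1 \<le> j) * (\<kappa> n j)\<^sup>2 / (2 * (l2norm (\<kappa> n))\<^sup>2)" for j
    by (simp add: weight_def power_divide power_mult_distrib of_bool_def)
  ultimately show "(\<lambda>j. (weight n j)\<^sup>2) sums (1 / 2)"
    using l2norm_kappa_pos[OF assms] by simp
qed

lemma negligible_weights_subsequence:
  assumes subseq: "filterlim ns at_top sequentially" "\<And>i. 1 \<le> ns i"
  shows "negligible_weights M \<xi> (\<lambda>i. weight (ns i)) (\<lambda>i. \<kappa> (ns i) 1 / (sqrt 2 * l2norm (\<kappa> (ns i))))"
proof
  fix i j
  show "0 \<le> weight (ns i) j"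
    using kappa_nonneg by (simp add: weight_def l2norm_nonneg)
  show "weight (ns i) j \<le> \<kappa> (ns i) 1 / (sqrt 2 * l2norm (\<kappa> (ns i)))"
    unfolding weight_def
    using nonincreasing_weights.antimono[OF nonincreasing_kappa[OF subseq(2)], of 1 j] kappa_nonneg
    by (intro divide_right_mono) (auto simp: l2norm_nonneg)
  show "summable (weight (ns i))" using weight_sums(1)[OF subseq(2)] by (rule sums_summable)
  show "(\<lambda>j. (weight (ns i) j)\<^sup>2) sums (1 / 2)" by (rule weight_sums(2)[OF subseq(2)])
  show "(\<lambda>i. \<kappa> (ns i) 1 / (sqrt 2 * l2norm (\<kappa> (ns i)))) \<longlonglongrightarrow> 0"
    using max_weight_tendsto_0 subseq(1) by (rule filterlim_compose)
qed

lemma std_signal_sums: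
  assumes n_ge_1: "1 \<le> n" and ell2_g: "ell2 g"
  shows "(\<lambda>j. weight n j * (std_signal n g j)\<^sup>2) sums snr n g"
proof -
  have "(\<lambda>j. of_bool (1 \<le> j) * (\<kappa> n j * (g j)\<^sup>2) / null_sd n) sums snr n g"
    unfolding snr_def energy_def
    by (intro sums_divide sums_infsum_atLeast1
        nonincreasing_weights.energy_summable[OF nonincreasing_kappa[OF n_ge_1] ell2_g])
  moreover have "of_bool (1 \<le> j) * (\<kappa> n j * (g j)\<^sup>2) / null_sd n
      = weight n j * (std_signal n g j)\<^sup>2" for j
    using n_ge_1 sigma l2norm_kappa_pos[OF n_ge_1]
    by (simp add: weight_def std_signal_def null_sd_def power_mult_distrib power_divide field_simps)
  ultimately show ?thesis by simp
qed

lemma noncentrality_std_signal: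
  "1 \<le> n \<Longrightarrow> ell2 g \<Longrightarrow> noncentrality (weight n) (std_signal n g) = snr n g"
  unfolding noncentrality_def using std_signal_sums by (rule sums_unique[symmetric])

lemma Tstat_eq_quad:
  assumes n_ge_1: "1 \<le> n"
  shows "Tstat \<sigma> \<kappa> \<xi> n g \<omega> = null_sd n * quad (weight n) (std_signal n g) \<omega>"
proof -
  have summand: "of_bool (1 \<le> j) * (\<kappa> n j * (g j + \<sigma> / sqrt (real n) * \<xi> j \<omega>)\<^sup>2)
      = null_sd n * (weight n j * (std_signal n g j + \<xi> j \<omega>)\<^sup>2)" for j
  proof -
    have "g j + \<sigma> / sqrt (real n) * \<xi> j \<omega> = \<sigma> / sqrt (real n) * (std_signal n g j + \<xi> j \<omega>)"
      using n_ge_1 sigma by (simp add: std_signal_def field_simps)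
    then have "(g j + \<sigma> / sqrt (real n) * \<xi> j \<omega>)\<^sup>2 = \<sigma>\<^sup>2 / real n * (std_signal n g j + \<xi> j \<omega>)\<^sup>2"
      by (simp add: power_mult_distrib power_divide)
    moreover have "of_bool (1 \<le> j) * \<kappa> n j = weight n j * (sqrt 2 * l2norm (\<kappa> n))"
      using l2norm_kappa_pos[OF n_ge_1] by (simp add: weight_def)
    ultimately show ?thesis unfolding null_sd_def by (simp add: mult_ac)
  qed
  have "(\<Sum>\<^sub>\<infinity>j\<in>{1..}. \<kappa> n j * (g j + \<sigma> / sqrt (real n) * \<xi> j \<omega>)\<^sup>2)
      = enn2real (\<Sum>j. ennreal (null_sd n * (weight n j * (std_signal n g j + \<xi> j \<omega>)\<^sup>2)))"
    using kappa_nonneg by (subst infsum_atLeast1_eq_enn2real) (simp_all only: summand, simp)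
  also have "\<dots> = null_sd n * enn2real (\<Sum>j. ennreal (weight n j * (std_signal n g j + \<xi> j \<omega>)\<^sup>2))"
    using null_sd_pos[OF n_ge_1] by (simp add: ennreal_mult' enn2real_mult)
  finally have raw_sum: "(\<Sum>\<^sub>\<infinity>j\<in>{1..}. \<kappa> n j * (g j + \<sigma> / sqrt (real n) * \<xi> j \<omega>)\<^sup>2)
      = null_sd n * enn2real (\<Sum>j. ennreal (weight n j * (std_signal n g j + \<xi> j \<omega>)\<^sup>2))" .
  have centering: "\<sigma>\<^sup>2 / real n * rho \<kappa> n = null_sd n * (\<Sum>j. weight n j)"
  proof -
    have "rho \<kappa> n = (\<Sum>j. weight n j) * (sqrt 2 * l2norm (\<kappa> n))"
      using l2norm_kappa_pos[OF n_ge_1] by (simp flip: sums_unique[OF weight_sums(1)[OF n_ge_1]])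
    then show ?thesis by (simp add: null_sd_def)
  qed
  show ?thesis
    unfolding Tstat_def quad_def raw_sum centering by (simp only: right_diff_distrib)
qed

lemma errII_eq_cdf:
  assumes "1 \<le> n"
  shows "errII M \<sigma> \<kappa> \<xi> n g t = cdf (quad_distr (weight n) (std_signal n g)) (t / null_sd n)"
  unfolding errII_def cdf_quad_distr Tstat_eq_quad[OF assms]
    pos_le_divide_eq[OF null_sd_pos[OF assms]]
  by (simp only: mult.commute)

lemma errI_eq_cdf:
  assumes "1 \<le> n"
  shows "errI M \<sigma> \<kappa> \<xi> n t = 1 - cdf (quad_distr (weight n) (\<lambda>_. 0)) (t / null_sd n)"
proof -
  have zero: "std_signal n (\<lambda>_. 0) = (\<lambda>_. 0)" by (simp add: std_signal_def fun_eq_iff)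
  have "{\<omega> \<in> space M. Tstat \<sigma> \<kappa> \<xi> n (\<lambda>_. 0) \<omega> > t}
      = space M - {\<omega> \<in> space M. quad (weight n) (\<lambda>_. 0) \<omega> \<le> t / null_sd n}"
    unfolding Tstat_eq_quad[OF assms] using null_sd_pos[OF assms] zero by (auto simp: field_simps)
  then show ?thesis unfolding errI_def cdf_quad_distr by (simp add: prob_compl)
qed

lemma consistent_if_snr_bounded_below:
  assumes subseq: "filterlim ns at_top sequentially" "\<And>i. 1 \<le> ns i"
    and ell2_g: "\<And>i. ell2 (g i)" and lower: "0 < a" "\<And>i. a \<le> snr (ns i) (g i)"
  shows "consistent M \<sigma> \<kappa> \<xi> ns g"
  unfolding consistent_def
proof (intro allI impI, elim conjE)
  fix \<alpha> :: real and t :: "nat \<Rightarrow> real"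
  assume level: "0 < \<alpha>" "\<alpha> < 1" "(\<lambda>i. errI M \<sigma> \<kappa> \<xi> (ns i) (t i)) \<longlonglongrightarrow> \<alpha>"
  interpret weights: negligible_weights M \<xi> "\<lambda>i. weight (ns i)"
    "\<lambda>i. \<kappa> (ns i) 1 / (sqrt 2 * l2norm (\<kappa> (ns i)))"
    by (rule negligible_weights_subsequence[OF subseq])
  have "(\<lambda>i. 1 - errI M \<sigma> \<kappa> \<xi> (ns i) (t i)) \<longlonglongrightarrow> 1 - \<alpha>" by (intro tendsto_intros level)
  then have null: "(\<lambda>i. cdf (quad_distr (weight (ns i)) (\<lambda>_. 0)) (t i / null_sd (ns i))) \<longlonglongrightarrow> 1 - \<alpha>"
    by (simp add: errI_eq_cdf[OF subseq(2)])
  have summable: "summable (\<lambda>j. weight (ns i) j * (std_signal (ns i) (g i) j)\<^sup>2)" for i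
    using std_signal_sums[OF subseq(2) ell2_g] by (rule sums_summable)
  have noncentrality_ge: "a \<le> noncentrality (weight (ns i)) (std_signal (ns i) (g i))" for i
    unfolding noncentrality_std_signal[OF subseq(2) ell2_g] by (rule lower(2))
  have "0 < 1 - \<alpha>" "1 - \<alpha> < 1" using level(1,2) by simp_all
  then obtain q where power: "q < 1 - \<alpha>"
    "\<forall>\<^sub>F i in sequentially.
      cdf (quad_distr (weight (ns i)) (std_signal (ns i) (g i))) (t i / null_sd (ns i)) \<le> q"
    by (rule weights.detectable_if_noncentrality_bounded_below[OF summable lower(1)
          noncentrality_ge _ _ null])
  then have "limsup (\<lambda>i. ereal (errII M \<sigma> \<kappa> \<xi> (ns i) (g i) (t i))) \<le> ereal q"
    by (intro Limsup_bounded) (simp add: errII_eq_cdf[OF subseq(2)])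
  also have "\<dots> < ereal (1 - \<alpha>)" using power(1) by simp
  finally show "limsup (\<lambda>i. ereal (errII M \<sigma> \<kappa> \<xi> (ns i) (g i) (t i))) < ereal (1 - \<alpha>)" .
qed

lemma inconsistent_if_snr_vanishes:
  assumes subseq: "filterlim ns at_top sequentially" "\<And>i. 1 \<le> ns i"
    and ell2_g: "\<And>i. ell2 (g i)" and vanishing: "(\<lambda>i. snr (ns i) (g i)) \<longlonglongrightarrow> 0"
  shows "inconsistent M \<sigma> \<kappa> \<xi> ns g"
  unfolding inconsistent_def
proof (rule allI, rule ereal_le_epsilon2)
  fix t :: "nat \<Rightarrow> real" and \<epsilon> :: real
  assume "0 < \<epsilon>"
  interpret weights: negligible_weights M \<xi> "\<lambda>i. weight (ns i)"
    "\<lambda>i. \<kappa> (ns i) 1 / (sqrt 2 * l2norm (\<kappa> (ns i)))"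
    by (rule negligible_weights_subsequence[OF subseq])
  let ?total = "\<lambda>i. errI M \<sigma> \<kappa> \<xi> (ns i) (t i) + errII M \<sigma> \<kappa> \<xi> (ns i) (g i) (t i)"
  have "summable (\<lambda>j. weight (ns i) j * (std_signal (ns i) (g i) j)\<^sup>2)" for i
    using std_signal_sums[OF subseq(2) ell2_g] by (rule sums_summable)
  then have "\<forall>\<^sub>F i in sequentially. \<forall>x. cdf (quad_distr (weight (ns i)) (\<lambda>_. 0)) x
      - cdf (quad_distr (weight (ns i)) (std_signal (ns i) (g i))) x \<le> \<epsilon>"
    using vanishing \<open>0 < \<epsilon>\<close> unfolding noncentrality_std_signal[OF subseq(2) ell2_g, symmetric]
    by (rule weights.undetectable_if_noncentrality_vanishes)
  then have "\<forall>\<^sub>F i in sequentially. ereal (1 - \<epsilon>) \<le> ereal (?total i)"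
  proof eventually_elim
    case (elim i)
    show ?case using spec[OF elim, of "t i / null_sd (ns i)"]
      by (simp add: errI_eq_cdf[OF subseq(2)] errII_eq_cdf[OF subseq(2)])
  qed
  then have "ereal (1 - \<epsilon>) \<le> liminf (\<lambda>i. ereal (?total i))" by (rule Liminf_bounded)
  then have "ereal (1 - \<epsilon>) + ereal \<epsilon> \<le> liminf (\<lambda>i. ereal (?total i)) + ereal \<epsilon>"
    by (rule add_right_mono)
  then show "1 \<le> liminf (\<lambda>i. ereal (?total i)) + ereal \<epsilon>" by (simp add: one_ereal_def)
qed

lemma not_inconsistent_if_consistent:
  assumes subseq: "filterlim ns at_top sequentially" "\<And>i. 1 \<le> ns i"
    and consistent: "consistent M \<sigma> \<kappa> \<xi> ns g"
  shows "\<not> inconsistent M \<sigma> \<kappa> \<xi> ns g"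
proof
  assume inconsistent: "inconsistent M \<sigma> \<kappa> \<xi> ns g"
  interpret weights: negligible_weights M \<xi> "\<lambda>i. weight (ns i)"
    "\<lambda>i. \<kappa> (ns i) 1 / (sqrt 2 * l2norm (\<kappa> (ns i)))"
    by (rule negligible_weights_subsequence[OF subseq])
  interpret N: real_distribution std_normal_distribution by (rule real_dist_normal_dist)
  let ?\<Phi> = "cdf std_normal_distribution"
    and ?I = "\<lambda>i. errI M \<sigma> \<kappa> \<xi> (ns i) 0" and ?II = "\<lambda>i. errII M \<sigma> \<kappa> \<xi> (ns i) (g i) 0"
  have Phi_0: "0 < ?\<Phi> 0" "?\<Phi> 0 < 1"
    using cdf_std_normal_strict_mono[THEN strict_monoD, of "-1" 0] N.cdf_nonneg[of "-1"]
      cdf_std_normal_strict_mono[THEN strict_monoD, of 0 1] N.cdf_bounded_prob[of 1] by simp_all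
  have level: "?I \<longlonglongrightarrow> 1 - ?\<Phi> 0"
    using tendsto_diff[OF tendsto_const weights.cdf_null_tendsto[of 0], of 1]
    by (simp add: errI_eq_cdf[OF subseq(2)])
  have "limsup (\<lambda>i. ereal (?II i)) < ereal (?\<Phi> 0)"
    using consistent[unfolded consistent_def, rule_format, of "1 - ?\<Phi> 0" "\<lambda>_. 0"] Phi_0 level
    by simp
  then obtain q where "limsup (\<lambda>i. ereal (?II i)) < ereal q" "ereal q < ereal (?\<Phi> 0)"
    using ereal_dense2 by blast
  then have power: "limsup (\<lambda>i. ereal (?II i)) < ereal q" "q < ?\<Phi> 0" by simp_all
  obtain p where between: "q < p" "p < ?\<Phi> 0" using dense[OF power(2)] by blast
  have "\<forall>\<^sub>F i in sequentially. ?I i < 1 - p"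
    using level between(2) by (intro order_tendstoD(2)) auto
  with Limsup_lessD[OF power(1)]
  have "\<forall>\<^sub>F i in sequentially. ereal (?I i + ?II i) \<le> ereal (1 - p + q)"
    by eventually_elim simp
  then have "limsup (\<lambda>i. ereal (?I i + ?II i)) \<le> ereal (1 - p + q)" by (rule Limsup_bounded)
  also have "\<dots> < 1" using between(1) by (simp add: one_ereal_def)
  also have "1 \<le> liminf (\<lambda>i. ereal (?I i + ?II i))"
    using inconsistent unfolding inconsistent_def by (rule spec[where x = "\<lambda>_. 0"])
  also have "\<dots> \<le> limsup (\<lambda>i. ereal (?I i + ?II i))" by (rule Liminf_le_Limsup) simp
  finally show False by simp
qed

end

lemma consistent_if_consistent_Suc:
  assumes "consistent M \<sigma> \<kappa> \<xi> (\<lambda>i. ns (Suc i)) (\<lambda>i. g (Suc i))"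
  shows "consistent M \<sigma> \<kappa> \<xi> ns g"
  unfolding consistent_def
proof (intro allI impI, elim conjE)
  fix \<alpha> :: real and t :: "nat \<Rightarrow> real"
  assume unit: "0 < \<alpha>" "\<alpha> < 1" and level: "(\<lambda>i. errI M \<sigma> \<kappa> \<xi> (ns i) (t i)) \<longlonglongrightarrow> \<alpha>"
  have "limsup (\<lambda>i. ereal (errII M \<sigma> \<kappa> \<xi> (ns (Suc i)) (g (Suc i)) (t (Suc i)))) < ereal (1 - \<alpha>)"
    using assms[unfolded consistent_def, rule_format, OF conjI[OF unit] LIMSEQ_Suc[OF level]] .
  then show "limsup (\<lambda>i. ereal (errII M \<sigma> \<kappa> \<xi> (ns i) (g i) (t i))) < ereal (1 - \<alpha>)"
    using limsup_shift[of "\<lambda>i. ereal (errII M \<sigma> \<kappa> \<xi> (ns i) (g i) (t i))"] by simp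
qed

section \<open>Frequency tightness\<close>

lemma subsequence_of_failures:
  fixes P :: "nat \<Rightarrow> nat \<Rightarrow> bool"
  assumes fails: "\<And>k. \<exists>n\<ge>1. P k n"
    and eventually: "\<And>n. 1 \<le> n \<Longrightarrow> \<forall>\<^sub>F k in sequentially. \<not> P k n"
    and antimono: "\<And>k l n. k \<le> l \<Longrightarrow> P l n \<Longrightarrow> P k n"
  shows "\<exists>ns. strict_mono ns \<and> (\<forall>i. 1 \<le> ns i \<and> P i (ns i))"
proof -
  have late: "\<exists>n>N. P k n" for k N
  proof -
    have "\<forall>\<^sub>F l in sequentially. \<forall>n\<in>{1..N}. \<not> P l n"
      using eventually by (intro eventually_ball_finite) auto
    with eventually_ge_at_top[of k] have "\<forall>\<^sub>F l in sequentially. k \<le> l \<and> (\<forall>n\<in>{1..N}. \<not> P l n)"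
      by (rule eventually_conj)
    then obtain l where beyond: "k \<le> l" "\<forall>n\<in>{1..N}. \<not> P l n"
      using eventually_happens'[OF sequentially_bot] by blast
    obtain n where "1 \<le> n" "P l n" using fails by blast
    then have "N < n" "P k n" using beyond antimono[of k l n] by auto
    then show ?thesis by blast
  qed
  have "\<exists>ns. \<forall>i. (1 \<le> ns i \<and> P i (ns i)) \<and> ns i < ns (Suc i)"
  proof (rule dependent_nat_choice)
    show "\<exists>n. 1 \<le> n \<and> P 0 n" using fails by blast
    show "\<exists>m. (1 \<le> m \<and> P (Suc i) m) \<and> n < m" for n i
      using late[of n "Suc i"] by (metis Suc_leI le_less_trans less_eq_nat.simps(1) One_nat_def)
  qed
  then show ?thesis by (auto simp: strict_mono_Suc_iff)
qed

context quadratic_test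
begin

definition frequency_tight :: "(nat \<Rightarrow> nat \<Rightarrow> real) \<Rightarrow> bool" where
  "frequency_tight f \<longleftrightarrow>
    (\<forall>\<epsilon>>0. \<exists>k. \<forall>n\<ge>1. l2norm (tail (k * kn \<kappa> n) (f n)) \<le> \<epsilon> * real n powr (-r))"

definition besov_approximable :: "(nat \<Rightarrow> nat \<Rightarrow> real) \<Rightarrow> bool" where
  "besov_approximable f \<longleftrightarrow> (\<forall>\<epsilon>>0. \<exists>P>0. \<exists>f1 :: nat \<Rightarrow> nat \<Rightarrow> real. \<forall>n\<ge>1.
        ell2 (f1 n) \<and> f1 n \<in> besov (r / (2 - 4 * r)) P
      \<and> l2norm (\<lambda>j. f n j - f1 n j) \<le> \<epsilon> * real n powr (-r)
      \<and> (l2norm (f n))^2 = (l2norm (f1 n))^2 + (l2norm (\<lambda>j. f n j - f1 n j))^2)"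

lemma powr_scaling:
  assumes "1 \<le> n"
  shows "(B * real n powr (-r))\<^sup>2 * real n powr (2*r) = B\<^sup>2"
proof -
  have "(B * real n powr (-r))\<^sup>2 * real n powr (2*r) = (B * (real n powr (-r) * real n powr r))\<^sup>2"
    using powr_add[of "real n" r r] by (simp add: power2_eq_square mult_ac)
  also have "real n powr (-r) * real n powr r = 1" using assms by (simp flip: powr_add)
  finally show ?thesis by simp
qed

lemma obtain_besov_tails_small:
  assumes "0 < P" "0 < \<epsilon>"
  obtains k where "\<And>n g. 1 \<le> n \<Longrightarrow> g \<in> besov (r / (2 - 4*r)) P
    \<Longrightarrow> l2norm (tail (k * kn \<kappa> n) g) \<le> \<epsilon> * real n powr (-r)"
proof -
  define s where "s = r / (2 - 4*r)"
  have "0 < s" unfolding s_def by (rule besov_exponent)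
  obtain C where "0 < C"
    and kn_powr: "\<And>n. 1 \<le> n \<Longrightarrow> real n powr (2*r) \<le> C * real (kn \<kappa> n) powr (2 * s)"
    using llessE[OF kn_powr_orders(1)] unfolding s_def by blast
  obtain k :: nat where "max 1 ((C * P / \<epsilon>\<^sup>2) powr (1 / (2 * s))) < real k"
    using reals_Archimedean2 by blast
  then have "1 \<le> k" "(C * P / \<epsilon>\<^sup>2) powr (1 / (2 * s)) \<le> real k" by auto
  then have "((C * P / \<epsilon>\<^sup>2) powr (1 / (2 * s))) powr (2 * s) \<le> real k powr (2 * s)"
    using \<open>0 < s\<close> by (intro powr_mono2) auto
  then have k_large: "C * P \<le> \<epsilon>\<^sup>2 * real k powr (2 * s)"
    using \<open>0 < s\<close> \<open>0 < C\<close> assms by (simp add: powr_powr field_simps)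
  show thesis
  proof (rule that)
    fix n :: nat and g
    assume n_ge_1: "1 \<le> n" and besov: "g \<in> besov (r / (2 - 4*r)) P"
    let ?t = "l2norm (tail (k * kn \<kappa> n) g)"
    have "real k powr (2 * s) * (?t\<^sup>2 * real n powr (2*r))
        \<le> real k powr (2 * s) * (?t\<^sup>2 * (C * real (kn \<kappa> n) powr (2 * s)))"
      using kn_powr[OF n_ge_1] by (intro mult_left_mono) auto
    also have "\<dots> = C * (real (k * kn \<kappa> n) powr (2 * s) * ?t\<^sup>2)" by (simp add: powr_mult mult_ac)
    also have "\<dots> \<le> C * P"
      using besov \<open>1 \<le> k\<close> kn_ge_1[OF n_ge_1] \<open>0 < C\<close> unfolding s_def
      by (intro mult_left_mono besov_tail_le) auto
    finally have "real k powr (2 * s) * (?t\<^sup>2 * real n powr (2*r)) \<le> real k powr (2 * s) * \<epsilon>\<^sup>2"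
      using k_large by (simp add: mult.commute)
    then have "?t\<^sup>2 * real n powr (2*r) \<le> (\<epsilon> * real n powr (-r))\<^sup>2 * real n powr (2*r)"
      using \<open>1 \<le> k\<close> by (simp add: powr_scaling[OF n_ge_1])
    then have "?t\<^sup>2 \<le> (\<epsilon> * real n powr (-r))\<^sup>2" using n_ge_1 by simp
    then show "?t \<le> \<epsilon> * real n powr (-r)" by (rule power2_le_imp_le) (use assms(2) in simp)
  qed
qed

lemma obtain_besov_radius:
  assumes "0 < B" "0 < k"
  obtains P where "0 < P" "\<And>n g. 1 \<le> n \<Longrightarrow> ell2 g \<Longrightarrow> l2norm g \<le> B * real n powr (-r)
    \<Longrightarrow> head (k * kn \<kappa> n) g \<in> besov (r / (2 - 4*r)) P"
proof -
  define s where "s = r / (2 - 4*r)"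
  have "0 < s" unfolding s_def by (rule besov_exponent)
  obtain C where "0 < C"
    and kn_powr: "\<And>n. 1 \<le> n \<Longrightarrow> real (kn \<kappa> n) powr (2 * s) \<le> C * real n powr (2*r)"
    using llessE[OF kn_powr_orders(2)] unfolding s_def by blast
  show thesis
  proof (rule that[of "real k powr (2 * s) * C * B\<^sup>2"])
    fix n :: nat and g
    assume n_ge_1: "1 \<le> n" and "ell2 g" and norm_le: "l2norm g \<le> B * real n powr (-r)"
    have "real (k * kn \<kappa> n) powr (2 * s) * (l2norm g)\<^sup>2
        \<le> (real k powr (2 * s) * (C * real n powr (2*r))) * (B * real n powr (-r))\<^sup>2"
      unfolding of_nat_mult using kn_powr[OF n_ge_1] norm_le l2norm_nonneg \<open>0 < C\<close>
      by (subst powr_mult) (auto intro!: mult_mono power_mono)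
    also have "\<dots> = real k powr (2 * s) * C * ((B * real n powr (-r))\<^sup>2 * real n powr (2*r))"
      by (simp add: mult_ac)
    also have "\<dots> = real k powr (2 * s) * C * B\<^sup>2" by (simp only: powr_scaling[OF n_ge_1])
    finally show "head (k * kn \<kappa> n) g \<in> besov (r / (2 - 4*r)) (real k powr (2 * s) * C * B\<^sup>2)"
      using head_in_besov[of s g "k * kn \<kappa> n"] besov_mono \<open>ell2 g\<close> \<open>0 < s\<close> unfolding s_def
      by fastforce
  qed (use assms \<open>0 < C\<close> in simp)
qed

lemma snr_ge_head:
  assumes "1 < k"
  obtains a where "0 < a" "\<And>n g. 1 \<le> n \<Longrightarrow> ell2 g
    \<Longrightarrow> a * (l2norm (head (k * kn \<kappa> n) g))\<^sup>2 * real n powr (2*r) \<le> snr n g"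
proof -
  have "1 < real k" using assms by simp
  then obtain K where "0 < K"
    and kappa_ge: "\<And>n. 1 \<le> n \<Longrightarrow> K * kappa_n \<kappa> n \<le> \<kappa> n (nat \<lfloor>real k * real (kn \<kappa> n)\<rfloor>)"
    using kappa_multiple_kn_ge by blast
  obtain C where "0 < C"
    and kappa_n_ge: "\<And>n. 1 \<le> n \<Longrightarrow> real n powr (2*r) \<le> C * (kappa_n \<kappa> n / null_sd n)"
    using llessE[OF kappa_n_div_null_sd_orders(1)] by blast
  show thesis
  proof (rule that[of "K / C"])
    fix n :: nat and g
    assume n_ge_1: "1 \<le> n" and ell2_g: "ell2 g"
    let ?m = "k * kn \<kappa> n"
    have "K / C * real n powr (2*r) \<le> K * kappa_n \<kappa> n / null_sd n"
      using mult_left_mono[OF kappa_n_ge[OF n_ge_1], of "K / C"] \<open>0 < C\<close> \<open>0 < K\<close> by simp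
    also have "\<dots> \<le> \<kappa> n ?m / null_sd n"
      using kappa_ge[OF n_ge_1] null_sd_pos[OF n_ge_1]
      by (intro divide_right_mono) (simp_all flip: of_nat_mult)
    finally have "K / C * real n powr (2*r) * (l2norm (head ?m g))\<^sup>2
        \<le> \<kappa> n ?m / null_sd n * (l2norm (head ?m g))\<^sup>2"
      by (rule mult_right_mono) simp
    also have "\<dots> \<le> snr n g"
      using nonincreasing_weights.energy_ge_head[OF nonincreasing_kappa[OF n_ge_1] ell2_g, of ?m]
        null_sd_pos[OF n_ge_1] by (simp add: snr_def divide_right_mono)
    finally show "K / C * (l2norm (head ?m g))\<^sup>2 * real n powr (2*r) \<le> snr n g"
      by (simp only: mult_ac)
  qed (use \<open>0 < K\<close> \<open>0 < C\<close> in simp)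
qed

lemma snr_tail_le:
  obtains K lam where "0 < K" "1 < lam" "\<And>k n g. 1 < k \<Longrightarrow> 1 \<le> n \<Longrightarrow> ell2 g \<Longrightarrow>
    snr n (tail (k * kn \<kappa> n) g) \<le> K * real k powr (- lam) * ((l2norm g)\<^sup>2 * real n powr (2*r))"
proof -
  obtain C1 lam where "0 < C1" "1 < lam" and decay: "\<And>\<delta> n. 0 < \<delta> \<Longrightarrow> 1 \<le> n \<Longrightarrow>
      \<kappa> n (nat \<lfloor>(1 + \<delta>) * real (kn \<kappa> n)\<rfloor>) < C1 * (1 + \<delta>) powr (- lam) * kappa_n \<kappa> n"
    using kappa_decay by metis
  obtain C where "0 < C"
    and kappa_n_le: "\<And>n. 1 \<le> n \<Longrightarrow> kappa_n \<kappa> n / null_sd n \<le> C * real n powr (2*r)"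
    using llessE[OF kappa_n_div_null_sd_orders(2)] by blast
  show thesis
  proof (rule that[of "C1 * C" lam])
    fix k n :: nat and g
    assume "1 < k" and n_ge_1: "1 \<le> n" and ell2_g: "ell2 g"
    let ?m = "k * kn \<kappa> n"
    note kappa = nonincreasing_kappa[OF n_ge_1] and sd_pos = null_sd_pos[OF n_ge_1]
    have "1 \<le> ?m" using \<open>1 < k\<close> kn_ge_1[OF n_ge_1] by (simp add: Suc_le_eq)
    then have "snr n (tail ?m g) \<le> \<kappa> n ?m * (l2norm (tail ?m g))\<^sup>2 / null_sd n"
      unfolding snr_def using sd_pos
      by (intro divide_right_mono nonincreasing_weights.energy_le[OF kappa ell2_tail[OF ell2_g]])
         (auto simp: tail_def)
    also have "\<dots> \<le> C1 * real k powr (- lam) * kappa_n \<kappa> n * (l2norm g)\<^sup>2 / null_sd n"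
    proof (intro divide_right_mono mult_mono power_mono l2norm_tail_le l2norm_nonneg ell2_g)
      show "\<kappa> n ?m \<le> C1 * real k powr (- lam) * kappa_n \<kappa> n"
        using decay[of "real k - 1" n] \<open>1 < k\<close> n_ge_1 by (simp flip: of_nat_mult)
    qed (use \<open>0 < C1\<close> kappa_n_nonneg sd_pos in auto)
    also have "\<dots> = C1 * real k powr (- lam) * (l2norm g)\<^sup>2 * (kappa_n \<kappa> n / null_sd n)" by simp
    also have "\<dots> \<le> C1 * real k powr (- lam) * (l2norm g)\<^sup>2 * (C * real n powr (2*r))"
      using kappa_n_le[OF n_ge_1] \<open>0 < C1\<close> by (intro mult_left_mono) auto
    finally show "snr n (tail ?m g)
        \<le> C1 * C * real k powr (- lam) * ((l2norm g)\<^sup>2 * real n powr (2*r))"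
      by (simp only: mult_ac)
  qed (use \<open>0 < C1\<close> \<open>1 < lam\<close> \<open>0 < C\<close> in auto)
qed

end

locale signal_sequence = quadratic_test M \<xi> \<sigma> r \<kappa>
  for M :: "'a measure" and \<xi> and \<sigma> r :: real and \<kappa> +
  fixes f :: "nat \<Rightarrow> nat \<Rightarrow> real" and c C :: real
  assumes ell2_f: "\<And>n. ell2 (f n)" and c_pos: "0 < c" and C_pos: "0 < C"
    and norm_ge: "\<And>n. 1 \<le> n \<Longrightarrow> c * real n powr (-r) \<le> l2norm (f n)"
    and norm_le: "\<And>n. 1 \<le> n \<Longrightarrow> l2norm (f n) \<le> C * real n powr (-r)"
begin

lemma frequency_tightE:
  assumes "frequency_tight f" and "0 < \<epsilon>"
  obtains k :: nat where "1 < k"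
    "\<And>n. 1 \<le> n \<Longrightarrow> l2norm (tail (k * kn \<kappa> n) (f n)) \<le> \<epsilon> * real n powr (-r)"
proof -
  obtain k where cutoff:
    "\<And>n. 1 \<le> n \<Longrightarrow> l2norm (tail (k * kn \<kappa> n) (f n)) \<le> \<epsilon> * real n powr (-r)"
    using assms unfolding frequency_tight_def by blast
  show thesis
  proof (rule that[of "k + 2"])
    show "l2norm (tail ((k + 2) * kn \<kappa> n) (f n)) \<le> \<epsilon> * real n powr (-r)" if "1 \<le> n" for n
      by (rule order_trans[OF l2norm_tail_antimono[OF ell2_f] cutoff[OF that]]) simp
  qed simp
qed

lemma frequency_tight_if_besov_approximable:
  assumes approximable: "besov_approximable f"
  shows "frequency_tight f"
  unfolding frequency_tight_def
proof (intro allI impI)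
  fix \<epsilon> :: real
  assume "0 < \<epsilon>"
  then have "0 < \<epsilon> / 2" by simp
  then obtain P f1 where "0 < P" and approximant: "\<And>n. 1 \<le> n \<Longrightarrow> ell2 (f1 n)"
    "\<And>n. 1 \<le> n \<Longrightarrow> f1 n \<in> besov (r / (2 - 4*r)) P"
    "\<And>n. 1 \<le> n \<Longrightarrow> l2norm (\<lambda>j. f n j - f1 n j) \<le> \<epsilon> / 2 * real n powr (-r)"
    using approximable[unfolded besov_approximable_def, rule_format, of "\<epsilon> / 2"] by blast
  obtain k where cutoff: "\<And>n g. 1 \<le> n \<Longrightarrow> g \<in> besov (r / (2 - 4*r)) P
      \<Longrightarrow> l2norm (tail (k * kn \<kappa> n) g) \<le> \<epsilon> / 2 * real n powr (-r)"
    using obtain_besov_tails_small[OF \<open>0 < P\<close> \<open>0 < \<epsilon> / 2\<close>] by blast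
  have "l2norm (tail (k * kn \<kappa> n) (f n)) \<le> \<epsilon> * real n powr (-r)" if n_ge_1: "1 \<le> n" for n
  proof -
    let ?m = "k * kn \<kappa> n" and ?rest = "\<lambda>j. f n j - f1 n j"
    have rest: "ell2 ?rest" by (intro ell2_diff ell2_f approximant(1) n_ge_1)
    have "tail ?m (f n) = (\<lambda>j. tail ?m (f1 n) j + tail ?m ?rest j)"
      by (auto simp: tail_def)
    then have "l2norm (tail ?m (f n)) \<le> l2norm (tail ?m (f1 n)) + l2norm (tail ?m ?rest)"
      using l2norm_triangle_ineq[OF ell2_tail[OF approximant(1)[OF n_ge_1]] ell2_tail[OF rest]]
      by simp
    also have "\<dots> \<le> \<epsilon> / 2 * real n powr (-r) + \<epsilon> / 2 * real n powr (-r)"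
      by (intro add_mono cutoff n_ge_1 approximant(2)
          order_trans[OF l2norm_tail_le[OF rest] approximant(3)])
    finally show ?thesis by simp
  qed
  then show "\<exists>k. \<forall>n\<ge>1. l2norm (tail (k * kn \<kappa> n) (f n)) \<le> \<epsilon> * real n powr (-r)" by blast
qed

lemma besov_approximable_if_frequency_tight:
  assumes tight: "frequency_tight f"
  shows "besov_approximable f"
  unfolding besov_approximable_def
proof (intro allI impI)
  fix \<epsilon> :: real
  assume "0 < \<epsilon>"
  obtain k where "1 < k"
    and cutoff: "\<And>n. 1 \<le> n \<Longrightarrow> l2norm (tail (k * kn \<kappa> n) (f n)) \<le> \<epsilon> * real n powr (-r)"
    using frequency_tightE[OF tight \<open>0 < \<epsilon>\<close>] by blast
  obtain P where "0 < P"
    and radius: "\<And>n g. 1 \<le> n \<Longrightarrow> ell2 g \<Longrightarrow> l2norm g \<le> C * real n powr (-r)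
      \<Longrightarrow> head (k * kn \<kappa> n) g \<in> besov (r / (2 - 4*r)) P"
    using obtain_besov_radius[of C k] C_pos \<open>1 < k\<close> by auto
  let ?f1 = "\<lambda>n. head (k * kn \<kappa> n) (f n)"
  have "ell2 (?f1 n) \<and> ?f1 n \<in> besov (r / (2 - 4 * r)) P
      \<and> l2norm (\<lambda>j. f n j - ?f1 n j) \<le> \<epsilon> * real n powr (-r)
      \<and> (l2norm (f n))^2 = (l2norm (?f1 n))^2 + (l2norm (\<lambda>j. f n j - ?f1 n j))^2"
    if "1 \<le> n" for n
    unfolding diff_head
    using radius[OF that ell2_f norm_le[OF that]] cutoff[OF that] ell2_head[OF ell2_f]
      l2norm_head_tail[OF ell2_f] by blast
  with \<open>0 < P\<close> show "\<exists>P>0. \<exists>f1 :: nat \<Rightarrow> nat \<Rightarrow> real. \<forall>n\<ge>1.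
        ell2 (f1 n) \<and> f1 n \<in> besov (r / (2 - 4 * r)) P
      \<and> l2norm (\<lambda>j. f n j - f1 n j) \<le> \<epsilon> * real n powr (-r)
      \<and> (l2norm (f n))^2 = (l2norm (f1 n))^2 + (l2norm (\<lambda>j. f n j - f1 n j))^2"
    by (intro exI[of _ P] conjI exI[of _ ?f1] allI impI) blast+
qed

lemma snr_bounded_below_if_frequency_tight:
  assumes tight: "frequency_tight f" and "0 < b"
  obtains a where "0 < a"
    "\<And>n g. 1 \<le> n \<Longrightarrow> ell2 g \<Longrightarrow> l2inner g (\<lambda>j. f n j - g j) = 0
      \<Longrightarrow> b * real n powr (-r) \<le> l2norm g \<Longrightarrow> a \<le> snr n g"
proof -
  have "0 < b / 2" using \<open>0 < b\<close> by simp
  then obtain k where "1 < k"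
    and cutoff: "\<And>n. 1 \<le> n \<Longrightarrow> l2norm (tail (k * kn \<kappa> n) (f n)) \<le> b / 2 * real n powr (-r)"
    using frequency_tightE[OF tight] by blast
  obtain K where "0 < K" and snr_ge: "\<And>n g. 1 \<le> n \<Longrightarrow> ell2 g
      \<Longrightarrow> K * (l2norm (head (k * kn \<kappa> n) g))\<^sup>2 * real n powr (2*r) \<le> snr n g"
    using snr_ge_head[OF \<open>1 < k\<close>] by blast
  show thesis
  proof (rule that[of "K * (b\<^sup>2 / (2 * C))\<^sup>2"])
    fix n :: nat and g
    assume n_ge_1: "1 \<le> n" and ell2_g: "ell2 g" and orth: "l2inner g (\<lambda>j. f n j - g j) = 0"
      and large: "b * real n powr (-r) \<le> l2norm g"
    let ?G = "l2norm (head (k * kn \<kappa> n) g)"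
    have "(b * real n powr (-r))\<^sup>2 \<le> (l2norm g)\<^sup>2"
      using large \<open>0 < b\<close> by (intro power_mono) auto
    also have "\<dots> \<le> 2 * (?G * l2norm (f n))"
      using cutoff[OF n_ge_1] large
      by (intro l2norm_square_le_head_if_orthogonal ell2_g ell2_f orth) simp
    also have "\<dots> \<le> 2 * (?G * (C * real n powr (-r)))"
      using norm_le[OF n_ge_1] by (intro mult_left_mono l2norm_nonneg) auto
    finally have "b\<^sup>2 / (2 * C) * real n powr (-r) \<le> ?G"
      using C_pos n_ge_1 by (simp add: power2_eq_square field_simps)
    then have "(b\<^sup>2 / (2 * C) * real n powr (-r))\<^sup>2 \<le> ?G\<^sup>2"
      using C_pos by (intro power_mono) auto
    then have "K * ((b\<^sup>2 / (2 * C) * real n powr (-r))\<^sup>2 * real n powr (2*r))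
        \<le> K * (?G\<^sup>2 * real n powr (2*r))"
      using \<open>0 < K\<close> by (intro mult_left_mono mult_right_mono) auto
    also have "\<dots> \<le> snr n g" using snr_ge[OF n_ge_1 ell2_g] by (simp only: mult.assoc)
    finally show "K * (b\<^sup>2 / (2 * C))\<^sup>2 \<le> snr n g" unfolding powr_scaling[OF n_ge_1] .
  qed (use \<open>0 < K\<close> C_pos \<open>0 < b\<close> in simp)
qed

lemma r_consistent_if_frequency_tight:
  assumes tight: "frequency_tight f"
  shows "r_consistent M \<sigma> \<kappa> \<xi> r f"
  unfolding r_consistent_def
proof
  have self_orthogonal: "l2inner (f n) (\<lambda>j. f n j - f n j) = 0" for n by (simp add: l2inner_def)
  obtain a where "0 < a" "\<And>n. 1 \<le> n \<Longrightarrow> a \<le> snr n (f n)"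
    using snr_bounded_below_if_frequency_tight[OF tight c_pos] ell2_f self_orthogonal norm_ge
    by metis
  then have "consistent M \<sigma> \<kappa> \<xi> Suc (\<lambda>i. f (Suc i))"
    by (intro consistent_if_snr_bounded_below filterlim_Suc ell2_f) auto
  then show "consistent M \<sigma> \<kappa> \<xi> id f"
    using consistent_if_consistent_Suc[of M \<sigma> \<kappa> \<xi> id f] by simp
  have "c / 2 * real n powr (-r) < l2norm (f n) \<and> l2norm (f n) < (C + c) * real n powr (-r)"
    if "1 \<le> n" for n
  proof -
    have "0 < c * real n powr (-r)" using c_pos that by simp
    then show ?thesis using norm_ge[OF that] norm_le[OF that] by (simp add: distrib_right)
  qed
  moreover have "0 < c / 2" "c / 2 < C + c" using c_pos C_pos by auto
  ultimately show "\<exists>c C. 0 < c \<and> c < C \<and> (\<forall>n\<ge>1. c * real n powr (-r) < l2norm (f n)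
                                      \<and> l2norm (f n) < C * real n powr (-r))" by blast
qed

lemma purely_r_consistent_if_frequency_tight:
  assumes tight: "frequency_tight f"
  shows "purely_r_consistent M \<sigma> \<kappa> \<xi> r f"
  unfolding purely_r_consistent_def
proof (intro conjI notI)
  show "r_consistent M \<sigma> \<kappa> \<xi> r f" by (rule r_consistent_if_frequency_tight[OF tight])
next
  assume "\<exists>ns f2 c1. strict_mono ns \<and> (\<forall>i. 1 \<le> ns i) \<and> 0 < c1 \<and>
          (\<forall>i. ell2 (f2 i) \<and> l2inner (f2 i) (\<lambda>j. f (ns i) j - f2 i j) = 0
               \<and> l2norm (f2 i) > c1 * real (ns i) powr (-r)) \<and>
          inconsistent M \<sigma> \<kappa> \<xi> ns f2"
  then obtain ns f2 c1 where subseq: "strict_mono ns" "\<And>i. 1 \<le> ns i" and "0 < c1"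
    and component: "\<And>i. ell2 (f2 i)" "\<And>i. l2inner (f2 i) (\<lambda>j. f (ns i) j - f2 i j) = 0"
      "\<And>i. c1 * real (ns i) powr (-r) < l2norm (f2 i)"
    and inconsistent: "inconsistent M \<sigma> \<kappa> \<xi> ns f2" by blast
  obtain a where "0 < a" "\<And>i. a \<le> snr (ns i) (f2 i)"
    using snr_bounded_below_if_frequency_tight[OF tight \<open>0 < c1\<close>] subseq(2) component less_imp_le
    by metis
  then have "consistent M \<sigma> \<kappa> \<xi> ns f2"
    by (intro consistent_if_snr_bounded_below filterlim_subseq subseq component(1))
  then show False
    using not_inconsistent_if_consistent[OF filterlim_subseq[OF subseq(1)] subseq(2)] inconsistent
    by blast
qed

lemma inconsistent_tails:
  assumes subseq: "strict_mono ns" "\<And>i. 1 \<le> ns i"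
  shows "inconsistent M \<sigma> \<kappa> \<xi> ns (\<lambda>i. tail ((i + 2) * kn \<kappa> (ns i)) (f (ns i)))"
proof (rule inconsistent_if_snr_vanishes[OF filterlim_subseq[OF subseq(1)] subseq(2)
      ell2_tail[OF ell2_f]])
  obtain K lam where "0 < K" "1 < lam"
    and snr_le: "\<And>k n g. 1 < k \<Longrightarrow> 1 \<le> n \<Longrightarrow> ell2 g \<Longrightarrow>
      snr n (tail (k * kn \<kappa> n) g) \<le> K * real k powr (- lam) * ((l2norm g)\<^sup>2 * real n powr (2*r))"
    by (rule snr_tail_le) blast
  let ?snr = "\<lambda>i. snr (ns i) (tail ((i + 2) * kn \<kappa> (ns i)) (f (ns i)))"
  have upper: "?snr i \<le> K * C\<^sup>2 * real (i + 2) powr (- lam)" for i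
  proof -
    let ?n = "ns i"
    have "(l2norm (f ?n))\<^sup>2 * real ?n powr (2*r) \<le> (C * real ?n powr (-r))\<^sup>2 * real ?n powr (2*r)"
      by (intro mult_right_mono power_mono norm_le subseq(2) l2norm_nonneg) simp
    also have "\<dots> = C\<^sup>2" by (rule powr_scaling[OF subseq(2)])
    finally have "K * real (i + 2) powr (- lam) * ((l2norm (f ?n))\<^sup>2 * real ?n powr (2*r))
        \<le> K * real (i + 2) powr (- lam) * C\<^sup>2"
      using \<open>0 < K\<close> by (intro mult_left_mono) auto
    then show ?thesis
      using snr_le[of "i + 2" ?n "f ?n"] subseq(2)[of i] ell2_f by (simp add: mult_ac)
  qed
  have lower: "0 \<le> ?snr i" for i
    unfolding snr_def using null_sd_pos[OF subseq(2)]
    by (intro divide_nonneg_pos nonincreasing_weights.energy_nonneg nonincreasing_kappa subseq(2))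
  have limit: "(\<lambda>i. K * C\<^sup>2 * real (i + 2) powr (- lam)) \<longlonglongrightarrow> 0"
  proof -
    have "filterlim (\<lambda>i. real (i + 2)) at_top sequentially"
      by (rule filterlim_compose[OF filterlim_real_sequentially filterlim_add_const_nat_at_top])
    then have "(\<lambda>i. real (i + 2) powr (- lam)) \<longlonglongrightarrow> 0"
      using \<open>1 < lam\<close> by (intro tendsto_neg_powr) auto
    then show ?thesis by (rule tendsto_mult_right_zero)
  qed
  show "?snr \<longlonglongrightarrow> 0"
    by (rule tendsto_sandwich[OF _ _ tendsto_const limit])
       (simp_all only: lower upper eventually_True)
qed

lemma frequency_tight_if_purely_r_consistent:
  assumes pure: "purely_r_consistent M \<sigma> \<kappa> \<xi> r f"
  shows "frequency_tight f"
  unfolding frequency_tight_def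
proof (intro allI impI, rule ccontr)
  fix \<epsilon> :: real
  assume "0 < \<epsilon>"
    and not_tight: "\<not> (\<exists>k. \<forall>n\<ge>1. l2norm (tail (k * kn \<kappa> n) (f n)) \<le> \<epsilon> * real n powr (-r))"
  let ?tail = "\<lambda>k n. l2norm (tail ((k + 2) * kn \<kappa> n) (f n))"
  have fails: "\<exists>n\<ge>1. \<epsilon> * real n powr (-r) < ?tail k n" for k
    using not_tight by (meson not_le)
  have vanishing: "\<forall>\<^sub>F k in sequentially. \<not> \<epsilon> * real n powr (-r) < ?tail k n"
    if n_ge_1: "1 \<le> n" for n
  proof -
    have "filterlim (\<lambda>k. (k + 2) * kn \<kappa> n) sequentially sequentially"
      using kn_ge_1[OF n_ge_1] by (intro filterlim_subseq) (auto simp: strict_mono_def)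
    then have "(\<lambda>k. ?tail k n) \<longlonglongrightarrow> 0"
      by (rule filterlim_compose[OF l2norm_tail_tendsto_0[OF ell2_f]])
    moreover have "0 < \<epsilon> * real n powr (-r)" using \<open>0 < \<epsilon>\<close> n_ge_1 by simp
    ultimately have "\<forall>\<^sub>F k in sequentially. ?tail k n < \<epsilon> * real n powr (-r)"
      by (rule order_tendstoD(2))
    then show ?thesis by eventually_elim simp
  qed
  have "?tail l n \<le> ?tail k n" if "k \<le> l" for k l n
    using that by (intro l2norm_tail_antimono ell2_f mult_right_mono) auto
  then have antimono: "\<epsilon> * real n powr (-r) < ?tail k n"
    if "k \<le> l" "\<epsilon> * real n powr (-r) < ?tail l n" for k l n
    using that by (meson less_le_trans)
  have "\<exists>ns. strict_mono ns \<and> (\<forall>i. 1 \<le> ns i \<and> \<epsilon> * real (ns i) powr (-r) < ?tail i (ns i))"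
    using fails vanishing antimono by (rule subsequence_of_failures)
  then obtain ns where subseq: "strict_mono ns" "\<And>i. 1 \<le> ns i"
    and large: "\<And>i. \<epsilon> * real (ns i) powr (-r) < ?tail i (ns i)" by blast
  define f2 where "f2 i = tail ((i + 2) * kn \<kappa> (ns i)) (f (ns i))" for i
  have orthogonal: "l2inner (f2 i) (\<lambda>j. f (ns i) j - f2 i j) = 0" for i
    unfolding l2inner_def by (rule infsum_0) (simp add: f2_def tail_def)
  have component: "ell2 (f2 i)" "\<epsilon> * real (ns i) powr (-r) < l2norm (f2 i)" for i
    unfolding f2_def by (rule ell2_tail[OF ell2_f], rule large)
  have "inconsistent M \<sigma> \<kappa> \<xi> ns f2"
    using inconsistent_tails[OF subseq] by (simp only: f2_def[abs_def])
  then show False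
    using pure subseq \<open>0 < \<epsilon>\<close> orthogonal component unfolding purely_r_consistent_def by blast
qed

end

theorem theorem11:
  fixes M :: "'a measure" and \<xi> :: "nat \<Rightarrow> 'a \<Rightarrow> real"
    and \<sigma> r :: real and \<kappa> :: "nat \<Rightarrow> nat \<Rightarrow> real" and f :: "nat \<Rightarrow> nat \<Rightarrow> real"
  assumes P: "prob_space M"
    and indep: "prob_space.indep_vars M (\<lambda>_. borel) \<xi> UNIV"
    and gauss: "\<forall>j. distributed M lborel (\<xi> j) std_normal_density"
    and sigma: "\<sigma> > 0"
    and r: "0 < r" "r < 1/2"
    and kpos: "\<forall>n j. 0 \<le> \<kappa> n j"
    and ksum: "\<forall>n\<ge>1. \<kappa> n summable_on {1..}"
    and A1: "\<forall>n\<ge>1. \<forall>j\<ge>1. \<kappa> n (Suc j) \<le> \<kappa> n j"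
    and A2: "\<exists>C1 C2. 0 < C1 \<and> (\<forall>n\<ge>1.
               C1 < \<sigma> powr (-4) * (real n)^2 * (\<Sum>\<^sub>\<infinity>j\<in>{1..}. (\<kappa> n j)^2)
             \<and> \<sigma> powr (-4) * (real n)^2 * (\<Sum>\<^sub>\<infinity>j\<in>{1..}. (\<kappa> n j)^2) < C2)"
    and A3: "\<exists>c1 c2. 0 < c1 \<and> (\<forall>n\<ge>1. c1 * real n powr (-2*r) \<le> rho \<kappa> n
                                  \<and> rho \<kappa> n \<le> c2 * real n powr (-2*r))"
    and A4: "\<exists>C1 lam. C1 > 0 \<and> lam > 1 \<and> (\<forall>\<delta>>0. \<forall>n\<ge>1.
               \<kappa> n (nat \<lfloor>(1 + \<delta>) * real (kn \<kappa> n)\<rfloor>) < C1 * (1 + \<delta>) powr (-lam) * kappa_n \<kappa> n)"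
    and A5a: "\<exists>c C. 0 < c \<and> (\<forall>n\<ge>1. c * kappa_n \<kappa> n \<le> \<kappa> n 1 \<and> \<kappa> n 1 \<le> C * kappa_n \<kappa> n)"
    and A5b: "\<forall>c>1. \<exists>C>0. \<forall>n\<ge>1. \<kappa> n (nat \<lfloor>c * real (kn \<kappa> n)\<rfloor>) \<ge> C * kappa_n \<kappa> n"
    and fl2: "\<forall>n. ell2 (f n)"
    and fnorm: "\<exists>c C. 0 < c \<and> c < C \<and> (\<forall>n\<ge>1. c * real n powr (-r) \<le> l2norm (f n)
                                          \<and> l2norm (f n) \<le> C * real n powr (-r))"
  shows "purely_r_consistent M \<sigma> \<kappa> \<xi> r f \<longleftrightarrow>
    (\<forall>\<epsilon>>0. \<exists>P>0. \<exists>f1 :: nat \<Rightarrow> nat \<Rightarrow> real. \<forall>n\<ge>1.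
        ell2 (f1 n) \<and> f1 n \<in> besov (r / (2 - 4 * r)) P
      \<and> l2norm (\<lambda>j. f n j - f1 n j) \<le> \<epsilon> * real n powr (-r)
      \<and> (l2norm (f n))^2 = (l2norm (f1 n))^2 + (l2norm (\<lambda>j. f n j - f1 n j))^2)"
proof -
  obtain c C where "0 < c" "c < C" and norm_ge: "\<And>n. 1 \<le> n \<Longrightarrow> c * real n powr (-r) \<le> l2norm (f n)"
    and norm_le: "\<And>n. 1 \<le> n \<Longrightarrow> l2norm (f n) \<le> C * real n powr (-r)"
    using fnorm by blast
  have "0 < C" using \<open>0 < c\<close> \<open>c < C\<close> by simp
  have std_normal: "distributed M lborel (\<xi> j) std_normal_density" for j using gauss by blast
  have ell2_f: "ell2 (f n)" for n using fl2 by blast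
  interpret prob_space M by fact
  interpret signal_sequence M \<xi> \<sigma> r \<kappa> f c C
    by unfold_locales fact+
  have "purely_r_consistent M \<sigma> \<kappa> \<xi> r f \<longleftrightarrow> frequency_tight f"
    using purely_r_consistent_if_frequency_tight frequency_tight_if_purely_r_consistent by blast
  also have "\<dots> \<longleftrightarrow> besov_approximable f"
    using besov_approximable_if_frequency_tight frequency_tight_if_besov_approximable by blast
  finally show ?thesis unfolding besov_approximable_def .
qed

end
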